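(* Let $G=(V,E)$ be an undirected unweighted graph with $n$ nodes. For any $S\subseteq V$ and any integer $k\ge 1$, there is a polynomial time algorithm that computes a $(1,2k)$ $(S\times V)$-spanner of $G$ of size $O\!\left(n^{1+1/(2k+1)}(k|S|)^{k/(2k+1)}\right)$, i.e. a subgraph $H\subseteq G$ with that many edges such that $\delta_H(s,v)\le \delta_G(s,v)+2k$ for all $s\in S$ and $v\in V$.
   Context: For a graph $X$ and nodes $u,v$, $\delta_X(u,v)$ denotes the shortest-path distance between $u$ and $v$ in $X$. For $\alpha\ge 1,\beta\ge 0$ and $\mathcal{P}\subseteq V\times V$, an $(\alpha,\beta)$ $\mathcal{P}$-spanner of $G$ is a subgraph $H\subseteq G$ (on the same node set) such that $\delta_H(s,t)\le \alpha\,\delta_G(s,t)+\beta$ for all $(s,t)\in\mathcal{P}$. The size of a spanner is its number of edges. The $O(\cdot)$ hides an absolute constant independent of $n$, $k$ and $S$. *)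

theory Defs
  imports
    Complex_Main
    "HOL-Library.Extended_Real"
    "HOL-Library.Log_Nat"
    "HOL-Computational_Algebra.Polynomial"
begin

section \<open>Graphs and pairwise spanners\<close>

definition graph :: "'a set \<Rightarrow> 'a set set \<Rightarrow> bool" where
  "graph V E \<longleftrightarrow> finite V \<and> (\<forall>e\<in>E. e \<subseteq> V \<and> card e = 2)"

fun walk :: "'a set \<Rightarrow> 'a set set \<Rightarrow> 'a list \<Rightarrow> bool" where
  "walk V E [] \<longleftrightarrow> False"
| "walk V E [v] \<longleftrightarrow> v \<in> V"
| "walk V E (u # v # p) \<longleftrightarrow> u \<in> V \<and> {u, v} \<in> E \<and> walk V E (v # p)"

text \<open>The infimum of the empty set is \<open>\<infinity>\<close>, so nodes in different components have
  distance \<open>\<infinity>\<close>.\<close>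

definition graph_dist :: "'a set \<Rightarrow> 'a set set \<Rightarrow> 'a \<Rightarrow> 'a \<Rightarrow> enat" where
  "graph_dist V E u v =
     (INF p \<in> {p. walk V E p \<and> hd p = u \<and> last p = v}. enat (length p - 1))"

text \<open>A spanner has the same node set as the graph, so it is given by its edge set \<open>H\<close>.\<close>

definition pairwise_spanner ::
  "real \<Rightarrow> real \<Rightarrow> ('a \<times> 'a) set \<Rightarrow> 'a set \<Rightarrow> 'a set set \<Rightarrow> 'a set set \<Rightarrow> bool" where
  "pairwise_spanner \<alpha> \<beta> P V E H \<longleftrightarrow>
     1 \<le> \<alpha> \<and> 0 \<le> \<beta> \<and> P \<subseteq> V \<times> V \<and> H \<subseteq> E \<and>
     (\<forall>(s, t)\<in>P. ereal_of_enat (graph_dist V H s t)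
        \<le> ereal \<alpha> * ereal_of_enat (graph_dist V E s t) + ereal \<beta>)"


section \<open>A random access machine\<close>

text \<open>Structured programs over named, two-dimensional arrays of natural numbers, with indirect
  addressing; a scalar is the cell with indices \<open>0, 0\<close>.  Every assignment and every test costs
  one time unit.  The only arithmetic operations are addition and truncated subtraction:
  without multiplication the length in bits of a stored number grows by at most a constant
  per step, so that unit cost and logarithmic cost (hence also Turing machine time) are
  polynomially related.\<close>

type_synonym vname = string
type_synonym state = "vname \<Rightarrow> nat \<Rightarrow> nat \<Rightarrow> nat"

datatype aexp = Num nat | Cell vname aexp aexp | Plus aexp aexp | Minus aexp aexp

datatype bexp = Less aexp aexp | Eq aexp aexp | Not bexp | And bexp bexp

datatype com =
    Skip
  | Assign vname aexp aexp aexp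
  | Seq com com
  | If bexp com com
  | While bexp com

primrec aval :: "aexp \<Rightarrow> state \<Rightarrow> nat" where
  "aval (Num m) \<sigma> = m"
| "aval (Cell x a b) \<sigma> = \<sigma> x (aval a \<sigma>) (aval b \<sigma>)"
| "aval (Plus a b) \<sigma> = aval a \<sigma> + aval b \<sigma>"
| "aval (Minus a b) \<sigma> = aval a \<sigma> - aval b \<sigma>"

primrec bval :: "bexp \<Rightarrow> state \<Rightarrow> bool" where
  "bval (Less a b) \<sigma> \<longleftrightarrow> aval a \<sigma> < aval b \<sigma>"
| "bval (Eq a b) \<sigma> \<longleftrightarrow> aval a \<sigma> = aval b \<sigma>"
| "bval (Not b) \<sigma> \<longleftrightarrow> \<not> bval b \<sigma>"
| "bval (And b c) \<sigma> \<longleftrightarrow> bval b \<sigma> \<and> bval c \<sigma>"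

definition upd :: "state \<Rightarrow> vname \<Rightarrow> nat \<Rightarrow> nat \<Rightarrow> nat \<Rightarrow> state" where
  "upd \<sigma> x i j m = \<sigma>(x := (\<sigma> x)(i := (\<sigma> x i)(j := m)))"

text \<open>\<open>exec c \<sigma> t \<tau>\<close>: started in \<open>\<sigma>\<close>, the program \<open>c\<close> halts in \<open>\<tau>\<close> after time \<open>t\<close>.\<close>

inductive exec :: "com \<Rightarrow> state \<Rightarrow> nat \<Rightarrow> state \<Rightarrow> bool" where
  Skip: "exec Skip \<sigma> 1 \<sigma>"
| Assign: "exec (Assign x a b e) \<sigma> 1 (upd \<sigma> x (aval a \<sigma>) (aval b \<sigma>) (aval e \<sigma>))"
| Seq: "exec c \<sigma> t \<tau> \<Longrightarrow> exec d \<tau> t' \<rho> \<Longrightarrow> exec (Seq c d) \<sigma> (t + t') \<rho>"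
| IfTrue: "bval b \<sigma> \<Longrightarrow> exec c \<sigma> t \<tau> \<Longrightarrow> exec (If b c d) \<sigma> (1 + t) \<tau>"
| IfFalse: "\<not> bval b \<sigma> \<Longrightarrow> exec d \<sigma> t \<tau> \<Longrightarrow> exec (If b c d) \<sigma> (1 + t) \<tau>"
| WhileFalse: "\<not> bval b \<sigma> \<Longrightarrow> exec (While b c) \<sigma> 1 \<sigma>"
| WhileTrue: "bval b \<sigma> \<Longrightarrow> exec c \<sigma> t \<tau> \<Longrightarrow> exec (While b c) \<tau> t' \<rho>
    \<Longrightarrow> exec (While b c) \<sigma> (1 + t + t') \<rho>"


section \<open>Input and output of spanner algorithms\<close>

text \<open>The nodes are presented to the machine through a numbering \<open>vs\<close>, a list containing every
  node exactly once.  The graph is given by its adjacency matrix, the set \<open>S\<close> by its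
  characteristic vector; all cells not used for the input are \<open>0\<close>.\<close>

definition encode_input :: "'a list \<Rightarrow> 'a set set \<Rightarrow> 'a set \<Rightarrow> nat \<Rightarrow> state" where
  "encode_input vs E S k = (\<lambda>x i j.
     if x = ''n'' \<and> i = 0 \<and> j = 0 then length vs
     else if x = ''k'' \<and> i = 0 \<and> j = 0 then k
     else if x = ''E'' \<and> i < length vs \<and> j < length vs \<and> {vs ! i, vs ! j} \<in> E then 1
     else if x = ''S'' \<and> i < length vs \<and> j = 0 \<and> vs ! i \<in> S then 1
     else 0)"

definition decode_output :: "'a list \<Rightarrow> state \<Rightarrow> 'a set set" where
  "decode_output vs \<sigma> =
     {{vs ! i, vs ! j} | i j. i < length vs \<and> j < length vs \<and> \<sigma> ''H'' i j \<noteq> 0}"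

text \<open>The number \<open>k\<close> is counted with its binary length; the adjacency matrix and the
  characteristic vector have \<open>n\<^sup>2 + n\<close> bits, which is polynomially related to \<open>n\<close>.\<close>

definition input_size :: "nat \<Rightarrow> nat \<Rightarrow> nat" where
  "input_size n k = n + floorlog 2 k"

end

theory Submission
  imports Defs
begin

text \<open>For a parameter \<open>d\<close> let every node keep \<open>d\<close> of its edges; call the result \<open>W\<close>.  An edge outside
  \<open>W\<close> then has endpoints with at least \<open>d\<close> neighbours in \<open>W\<close>, and since a node has at most three
  neighbours on a shortest path, such a path contains at most \<open>3n/d\<close> edges outside \<open>W\<close>.  Treat the
  pairs \<open>(s, v)\<close> of \<open>S \<times> V\<close> one after the other.  If \<open>W\<close> makes a detour of more than \<open>2k\<close> from \<open>s\<close> to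
  \<open>v\<close>, follow a shortest path \<open>P\<close> backwards from \<open>v\<close> and add a final segment of \<open>P\<close> to \<open>W\<close>.  The segment
  starts at a node with detour \<open>e \<le> 2k\<close>, and is chosen such that its number of missing edges is at
  most \<open>q + 1\<close> times the number of those whose end node has a detour of more than \<open>e + 2\<close>.  Each such
  end node brings its \<open>d\<close> neighbours closer to \<open>s\<close>, and a pair of nodes can come closer only \<open>O(k)\<close>
  times once its detour is \<open>O(k)\<close>; hence \<open>O(q k |S| n / d)\<close> edges are added in total.  A suitable
  segment exists if \<open>(q + 1)\<^sup>k > 3n/d\<close>: otherwise one could reroute \<open>k\<close> times, each time at the cost of
  a detour of \<open>2\<close>, dividing the number of missing edges by more than \<open>q + 1\<close> each time.  Balancing
  \<open>n d\<close> against \<open>q k |S| n / d\<close> gives the bound.  The machine need not compute the optimal \<open>d\<close> and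
  \<open>q\<close>: it tries every \<open>d\<close> and keeps the smallest result, and it uses the least possible \<open>q\<close> for each
  purchase.\<close>

section \<open>Programs with bounded loops\<close>

text \<open>Every loop runs exactly \<open>n\<close> times, so the meaning of a program is a total function on states and
  its running time is bounded by a polynomial in \<open>n\<close> that depends only on its syntax.\<close>

datatype lcom =
    LAssign vname aexp aexp aexp
  | LSeq lcom lcom
  | LIf bexp lcom
  | LFor vname lcom

primrec compile :: "lcom \<Rightarrow> com" where
  "compile (LAssign x a b e) = Assign x a b e"
| "compile (LSeq c d) = Seq (compile c) (compile d)"
| "compile (LIf b c) = If b (compile c) Skip"
| "compile (LFor x c) = Seq (Assign x (Num 0) (Num 0) (Num 0))
     (While (Less (Cell x (Num 0) (Num 0)) (Cell ''n'' (Num 0) (Num 0)))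
       (Seq (compile c)
         (Assign x (Num 0) (Num 0) (Plus (Cell x (Num 0) (Num 0)) (Num 1)))))"

primrec writes :: "lcom \<Rightarrow> vname set" where
  "writes (LAssign x a b e) = {x}"
| "writes (LSeq c d) = writes c \<union> writes d"
| "writes (LIf b c) = writes c"
| "writes (LFor x c) = insert x (writes c)"

primrec wf_loops :: "lcom \<Rightarrow> bool" where
  "wf_loops (LAssign x a b e) \<longleftrightarrow> True"
| "wf_loops (LSeq c d) \<longleftrightarrow> wf_loops c \<and> wf_loops d"
| "wf_loops (LIf b c) \<longleftrightarrow> wf_loops c"
| "wf_loops (LFor x c) \<longleftrightarrow> x \<notin> writes c \<and> wf_loops c"

text \<open>The number \<open>n\<close> is a parameter and the counter is reset before every round,
  which makes a loop a plain \<open>fold\<close>. This agrees with the compiled loop as long as the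
  body writes neither the counter nor the cell \<open>n\<close>.\<close>

primrec sem :: "nat \<Rightarrow> lcom \<Rightarrow> state \<Rightarrow> state" where
  "sem n (LAssign x a b e) \<sigma> = upd \<sigma> x (aval a \<sigma>) (aval b \<sigma>) (aval e \<sigma>)"
| "sem n (LSeq c d) \<sigma> = sem n d (sem n c \<sigma>)"
| "sem n (LIf b c) \<sigma> = (if bval b \<sigma> then sem n c \<sigma> else \<sigma>)"
| "sem n (LFor x c) \<sigma> = upd (fold (\<lambda>j \<tau>. sem n c (upd \<tau> x 0 0 j)) [0..<n] \<sigma>) x 0 0 n"

text \<open>For a loop, \<open>[:0, 1:]\<close> is the number of rounds, each with a test and an
  increment besides the body; the last \<open>2\<close> pays the initial assignment and the failing
  test. The \<open>2\<close> of a conditional covers the test and a possible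
  \<open>Skip\<close>.\<close>

primrec time_poly :: "lcom \<Rightarrow> nat poly" where
  "time_poly (LAssign x a b e) = 1"
| "time_poly (LSeq c d) = time_poly c + time_poly d"
| "time_poly (LIf b c) = time_poly c + 2"
| "time_poly (LFor x c) = [:0, 1:] * (time_poly c + 2) + 2"

section \<open>Frame property, running time and the loop rule\<close>

lemma upd_apply: "upd \<sigma> x i j m y a b = (if y = x \<and> a = i \<and> b = j then m else \<sigma> y a b)"
  by (simp add: upd_def)

lemma upd_other [simp]: "y \<noteq> x \<Longrightarrow> upd \<sigma> x i j m y = \<sigma> y"
  by (simp add: upd_def)

lemma upd_same [simp]: "upd \<sigma> x i j m x i j = m"
  by (simp add: upd_def)

lemma upd_upd [simp]: "upd (upd \<sigma> x i j m) x i j m' = upd \<sigma> x i j m'"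
  by (simp add: upd_def fun_eq_iff)

lemma sem_frame: "x \<notin> writes c \<Longrightarrow> sem n c \<sigma> x = \<sigma> x"
proof (induction c arbitrary: \<sigma>)
  case (LFor y c)
  have "fold (\<lambda>j \<tau>. sem n c (upd \<tau> y 0 0 j)) js \<sigma> x = \<sigma> x" for js
    using LFor by (induction js arbitrary: \<sigma>) auto
  then show ?case using LFor.prems by simp
qed auto

lemma exec_compile:
  assumes "wf_loops c" "''n'' \<notin> writes c" "\<sigma> ''n'' 0 0 = n"
  shows "\<exists>t \<le> poly (time_poly c) n. exec (compile c) \<sigma> t (sem n c \<sigma>)"
  using assms
proof (induction c arbitrary: \<sigma>)
  case (LAssign x a b e)
  show ?case using exec.Assign[of x a b e \<sigma>] by (intro exI[of _ 1]) simp
next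
  case (LSeq c d)
  obtain t where t: "t \<le> poly (time_poly c) n" "exec (compile c) \<sigma> t (sem n c \<sigma>)"
    using LSeq.IH(1)[of \<sigma>] LSeq.prems by auto
  have "sem n c \<sigma> ''n'' 0 0 = n" using LSeq.prems by (simp add: sem_frame)
  then obtain t' where t': "t' \<le> poly (time_poly d) n"
      "exec (compile d) (sem n c \<sigma>) t' (sem n d (sem n c \<sigma>))"
    using LSeq.IH(2)[of "sem n c \<sigma>"] LSeq.prems by auto
  show ?case using exec.Seq[OF t(2) t'(2)] t(1) t'(1)
    by (intro exI[of _ "t + t'"]) simp
next
  case (LIf b c)
  obtain t where t: "t \<le> poly (time_poly c) n" "exec (compile c) \<sigma> t (sem n c \<sigma>)"
    using LIf.IH[of \<sigma>] LIf.prems by auto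
  show ?case
  proof (cases "bval b \<sigma>")
    case True
    then show ?thesis using exec.IfTrue[OF True t(2)] t(1) by (intro exI[of _ "1 + t"]) simp
  next
    case False
    then show ?thesis using exec.IfFalse[OF False exec.Skip] by (intro exI[of _ "1 + 1"]) simp
  qed
next
  case (LFor x c)
  define body where
    "body = Seq (compile c) (Assign x (Num 0) (Num 0) (Plus (Cell x (Num 0) (Num 0)) (Num 1)))"
  define test where "test = Less (Cell x (Num 0) (Num 0)) (Cell ''n'' (Num 0) (Num 0))"
  define it where "it = (\<lambda>j. fold (\<lambda>j \<tau>. sem n c (upd \<tau> x 0 0 j)) [0..<j] \<sigma>)"
  define T where "T = poly (time_poly c) n + 2"
  have x: "x \<noteq> ''n''" "x \<notin> writes c" using LFor.prems by auto
  have it_n: "it j ''n'' 0 0 = n" for j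
    unfolding it_def using LFor.prems by (induction j) (auto simp: sem_frame)
  have it_Suc: "it (Suc j) = sem n c (upd (it j) x 0 0 j)" for j
    unfolding it_def by simp
  \<comment> \<open>\<open>it j\<close> is the state after \<open>j\<close> rounds. The induction is
    on the number \<open>i\<close> of rounds still to come; the summand \<open>1\<close> is the
    final test.\<close>
  have loop: "\<exists>t \<le> i * T + 1. exec (While test body) (upd (it j) x 0 0 j) t (upd (it n) x 0 0 n)"
    if "i = n - j" "j \<le> n" for i j
    using that
  proof (induction i arbitrary: j)
    case 0
    then have "\<not> bval test (upd (it j) x 0 0 j)" "j = n"
      using x it_n by (auto simp: test_def)
    then show ?case using exec.WhileFalse[of test "upd (it j) x 0 0 j" body]
      by (intro exI[of _ 1]) auto
  next
    case (Suc i)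
    let ?\<tau> = "upd (it j) x 0 0 j"
    have n: "?\<tau> ''n'' 0 0 = n" using x it_n by simp
    have b: "bval test ?\<tau>" using Suc.prems x n by (auto simp: test_def)
    obtain t where t: "t \<le> poly (time_poly c) n" "exec (compile c) ?\<tau> t (it (Suc j))"
      using LFor.IH[of "?\<tau>"] n LFor.prems it_Suc by auto
    have xj: "it (Suc j) x 0 0 = j" using x it_Suc sem_frame by simp
    have "exec body ?\<tau> (t + 1) (upd (it (Suc j)) x 0 0 (Suc j))"
      unfolding body_def
      using exec.Seq[OF t(2) exec.Assign[of x "Num 0" "Num 0" "Plus (Cell x (Num 0) (Num 0)) (Num 1)"
        "it (Suc j)"]] xj by simp
    moreover have "i = n - Suc j" "Suc j \<le> n" using Suc.prems by linarith+
    then obtain t' where t': "t' \<le> i * T + 1"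
      "exec (While test body) (upd (it (Suc j)) x 0 0 (Suc j)) t' (upd (it n) x 0 0 n)"
      using Suc.IH[of "Suc j"] by auto
    ultimately have "exec (While test body) ?\<tau> (1 + (t + 1) + t') (upd (it n) x 0 0 n)"
      using exec.WhileTrue[OF b] by blast
    moreover have "1 + (t + 1) + t' \<le> Suc i * T + 1" using t(1) t'(1) by (simp add: T_def)
    ultimately show ?case by blast
  qed
  have "it 0 = \<sigma>" by (simp add: it_def)
  with loop[of n 0] obtain t where t: "t \<le> n * T + 1"
    "exec (While test body) (upd \<sigma> x 0 0 0) t (upd (it n) x 0 0 n)" by auto
  have "exec (compile (LFor x c)) \<sigma> (1 + t) (sem n (LFor x c) \<sigma>)"
    using exec.Seq[OF exec.Assign[of x "Num 0" "Num 0" "Num 0" \<sigma>]] t(2)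
    by (simp add: it_def body_def test_def)
  moreover have "1 + t \<le> poly (time_poly (LFor x c)) n"
    using t(1) by (simp add: T_def algebra_simps)
  ultimately show ?case by blast
qed

lemma poly_nat_mono: "m \<le> n \<Longrightarrow> poly p m \<le> poly p n" for p :: "nat poly"
  by (induction p) (auto intro!: add_mono mult_mono)

text \<open>A loop rule in which \<open>final\<close> absorbs the exit value of the counter, while
  \<open>step\<close> may assume for free that whatever the body does not write still has its value
  from the loop entry.\<close>

lemma sem_For_invariant:
  assumes "I 0 \<sigma>"
    and step: "\<And>j \<tau>. j < n \<Longrightarrow> I j \<tau> \<Longrightarrow> (\<And>y. y \<notin> insert x (writes c) \<Longrightarrow> \<tau> y = \<sigma> y) \<Longrightarrow>
      I (Suc j) (sem n c (upd \<tau> x 0 0 j))"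
    and final: "\<And>\<tau>. I n \<tau> \<Longrightarrow> Q (upd \<tau> x 0 0 n)"
  shows "Q (sem n (LFor x c) \<sigma>)"
proof -
  have "I j (fold (\<lambda>j \<tau>. sem n c (upd \<tau> x 0 0 j)) [0..<j] \<sigma>) \<and>
    (\<forall>y. y \<notin> insert x (writes c) \<longrightarrow> fold (\<lambda>j \<tau>. sem n c (upd \<tau> x 0 0 j)) [0..<j] \<sigma> y = \<sigma> y)"
    if "j \<le> n" for j
    using that by (induction j) (auto simp: assms(1) sem_frame intro!: step)
  then show ?thesis using final by auto
qed

declare sem.simps(4) [simp del]


section \<open>Distances and purchases\<close>

definition dist_cap :: "nat \<Rightarrow> (nat \<Rightarrow> nat \<Rightarrow> bool) \<Rightarrow> nat \<Rightarrow> nat \<Rightarrow> nat" where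
  "dist_cap M A s v = (if \<exists>l. (A ^^ l) s v then LEAST l. (A ^^ l) s v else M)"

lemma dist_cap_le: "(A ^^ l) s v \<Longrightarrow> dist_cap M A s v \<le> l"
  unfolding dist_cap_def by (auto intro: Least_le)

lemma relpowp_dist_cap: "(A ^^ l) s v \<Longrightarrow> (A ^^ dist_cap M A s v) s v"
  unfolding dist_cap_def by (auto intro: LeastI)

lemma dist_cap_self [simp]: "dist_cap M A s s = 0"
  using dist_cap_le[where l=0 and A=A and s=s and v=s and M=M] by simp

lemma dist_cap_unreachable: "(\<And>l. \<not> (A ^^ l) s v) \<Longrightarrow> dist_cap M A s v = M"
  unfolding dist_cap_def by auto

text \<open>A shortest walk cut after \<open>i\<close> steps ends at a node at distance exactly
  \<open>i\<close>, for a shorter way to that node would shorten the whole walk.\<close>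

lemma dist_cap_level:
  assumes "(A ^^ l) s v" "i \<le> dist_cap M A s v"
  shows "\<exists>w. dist_cap M A s w = i \<and> (A ^^ i) s w"
proof -
  let ?L = "dist_cap M A s v"
  have "(A ^^ (i + (?L - i))) s v" using relpowp_dist_cap[OF assms(1)] assms(2) by simp
  then obtain w where w: "(A ^^ i) s w" "(A ^^ (?L - i)) w v"
    unfolding relpowp_add by blast
  have "(A ^^ (dist_cap M A s w + (?L - i))) s v"
    using relpowp_trans[OF relpowp_dist_cap[OF w(1)] w(2)] .
  from dist_cap_le[OF this, of M] have "i \<le> dist_cap M A s w" using assms(2) by linarith
  with dist_cap_le[OF w(1)] w(1) show ?thesis using le_antisym by blast
qed

locale nat_graph =
  fixes n :: nat and A :: "nat \<Rightarrow> nat \<Rightarrow> bool"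
  assumes sym: "A x y \<Longrightarrow> A y x" and lt: "A x y \<Longrightarrow> x < n"
begin

lemma relpowp_lt: "(A ^^ l) s v \<Longrightarrow> s < n \<Longrightarrow> v < n"
  by (cases l) (auto dest: sym lt)

text \<open>By \<open>dist_cap_level\<close> all values from \<open>0\<close> up to the distance
  occur as distances of nodes below \<open>n\<close>, and there are only \<open>n\<close> of
  those.\<close>

lemma dist_cap_lt:
  assumes "(A ^^ l) s v" "s < n"
  shows "dist_cap M A s v < n"
proof -
  have "{..dist_cap M A s v} \<subseteq> dist_cap M A s ` {..<n}"
    using dist_cap_level[OF assms(1)] relpowp_lt assms(2) by fastforce
  from card_mono[OF _ this] card_image_le[of "{..<n}" "dist_cap M A s"] show ?thesis by simp
qed

text \<open>As \<open>n \<le> M\<close>, the default value \<open>M\<close> cannot be confused with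
  a real distance.\<close>

lemma dist_cap_cases:
  assumes "s < n" "n \<le> M"
  obtains "dist_cap M A s v = M" "\<And>l. \<not> (A ^^ l) s v"
  | "dist_cap M A s v < n" "(A ^^ dist_cap M A s v) s v"
  using dist_cap_lt[OF _ assms(1)] relpowp_dist_cap dist_cap_unreachable by metis

lemma dist_cap_edge:
  assumes "s < n" "n \<le> M" "A u v"
  shows "dist_cap M A s v \<le> dist_cap M A s u + 1"
proof (cases rule: dist_cap_cases[OF assms(1,2), of u])
  case 1
  have "dist_cap M A s v \<le> M"
    by (cases rule: dist_cap_cases[OF assms(1,2), of v]) (use assms in auto)
  with 1 show ?thesis by simp
next
  case 2
  then have "(A ^^ (dist_cap M A s u + 1)) s v" using assms(3) by auto
  then show ?thesis by (rule dist_cap_le)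
qed

lemma dist_cap_pred:
  assumes "s < n" "n \<le> M" "(A ^^ l) s v" "0 < dist_cap M A s v"
  obtains u where "u < n" "A u v" "dist_cap M A s u + 1 = dist_cap M A s v"
proof -
  obtain m where m: "dist_cap M A s v = Suc m" using assms(4) gr0_implies_Suc by blast
  then have "(A ^^ Suc m) s v" using relpowp_dist_cap[OF assms(3), of M] by simp
  then obtain u where u: "(A ^^ m) s u" "A u v" by auto
  have "dist_cap M A s v \<le> dist_cap M A s u + 1" by (rule dist_cap_edge[OF assms(1,2) u(2)])
  with dist_cap_le[OF u(1), of M] m u that[of u] lt show ?thesis by auto
qed

end

text \<open>A node that is reachable in \<open>B\<close> only is at distance below
  \<open>n \<le> M\<close> there, so the default value in \<open>A\<close> does not break
  monotonicity.\<close>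

lemma dist_cap_antimono:
  assumes "nat_graph n A" "nat_graph n B" "s < n" "n \<le> M" "\<And>x y. A x y \<Longrightarrow> B x y"
  shows "dist_cap M B s v \<le> dist_cap M A s v"
proof (cases rule: nat_graph.dist_cap_cases[OF assms(1,3,4), of v])
  case 1
  then show ?thesis
    by (cases rule: nat_graph.dist_cap_cases[OF assms(2,3,4), of v]) (use assms in auto)
next
  case 2
  then show ?thesis using relpowp_mono[of A B, OF assms(5)] dist_cap_le by blast
qed

section \<open>The potential, and segments of shortest paths that can be bought\<close>

locale spanner_input = nat_graph n E for n E +
  fixes k :: nat and S :: "nat set"
  assumes S_lt: "S \<subseteq> {..<n}" and k_ge1: "k \<ge> 1"
begin

text \<open>\<open>M\<close> stands for infinity.  It is so large that an unreachable node counts as improved, and that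
  reaching it lowers the potential \<open>pot\<close> below.\<close>

abbreviation "M \<equiv> n + k + k + 2"
abbreviation "\<delta> \<equiv> dist_cap M"

text \<open>The cap limits the contribution of a pair to the order of \<open>k\<close>. It is
  \<open>2 * k + 3\<close> because a purchase leaves the neighbours of improved nodes with detours
  of at most \<open>2 * k + 2\<close>, so that the cap cannot hide their decrease.\<close>

definition pot where
  "pot W = (\<Sum>s\<in>S. \<Sum>z<n. min (\<delta> W s z - \<delta> E s z) (2 * k + 3))"

text \<open>Adjacency relations are symmetric, so every edge contributes two cells.\<close>

definition cells :: "(nat \<Rightarrow> nat \<Rightarrow> bool) \<Rightarrow> (nat \<times> nat) set" where
  "cells W = {(x, y). W x y}"

definition subgraph :: "(nat \<Rightarrow> nat \<Rightarrow> bool) \<Rightarrow> bool" where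
  "subgraph W \<longleftrightarrow> nat_graph n W \<and> (\<forall>x y. W x y \<longrightarrow> E x y)"

text \<open>Adding edges preserves this property, so it survives all purchases. Ordered pairs are
  used, so for symmetric \<open>E\<close> and \<open>W\<close> both endpoints of a missing edge are
  covered.\<close>

definition dense :: "nat \<Rightarrow> (nat \<Rightarrow> nat \<Rightarrow> bool) \<Rightarrow> bool" where
  "dense d W \<longleftrightarrow> (\<forall>x y. E x y \<longrightarrow> \<not> W x y \<longrightarrow> d \<le> card {z. W x z})"

text \<open>Paths are indexed from \<open>v\<close> towards \<open>s\<close>. An edge thus carries
  the index of its endpoint nearer to \<open>v\<close>, and a final segment of the path consists of
  the indices below \<open>a\<close>.\<close>

definition missing where
  "missing W P a = {i. i < a \<and> \<not> W (P i) (P (Suc i))}"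

text \<open>If the edges of \<open>P\<close> between \<open>P a\<close> and \<open>v\<close> are bought, the detour that \<open>W\<close> makes on the way
  from \<open>s\<close> to \<open>P i\<close> drops to that of \<open>P a\<close>.  The condition below asks for a drop by more than \<open>2\<close>, so
  that every neighbour of \<open>P i\<close> comes strictly closer to \<open>s\<close> as well.\<close>

definition improved where
  "improved W s P a = {i \<in> missing W P a. \<delta> E s (P i) + \<delta> W s (P a) + 2 < \<delta> W s (P i) + \<delta> E s (P a)}"

text \<open>The form \<open>k + k\<close> matches the test made by the machine, which cannot
  multiply.\<close>

definition affordable where
  "affordable W s P q a \<longleftrightarrow> \<delta> W s (P a) \<le> \<delta> E s (P a) + k + k \<and>
     card (missing W P a) \<le> (q + 1) * card (improved W s P a)"

definition shortest_path where
  "shortest_path s v P \<longleftrightarrow> P 0 = v \<and> (\<exists>l. (E ^^ l) s v) \<and>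
     (\<forall>i<\<delta> E s v. E (P (Suc i)) (P i) \<and> \<delta> E s (P (Suc i)) + 1 = \<delta> E s (P i))"

lemma shortest_path_lt:
  assumes "shortest_path s v P" "v < n" "i \<le> \<delta> E s v"
  shows "P i < n"
proof (cases i)
  case 0
  then show ?thesis using assms by (simp add: shortest_path_def)
next
  case (Suc j)
  then have "E (P (Suc j)) (P j)" using assms by (simp add: shortest_path_def)
  then show ?thesis using lt Suc by simp
qed

definition buy where
  "buy W P a x y \<longleftrightarrow> W x y \<or> (\<exists>i<a. (x = P i \<and> y = P (Suc i)) \<or> (x = P (Suc i) \<and> y = P i))"

lemma finite_cells: "subgraph W \<Longrightarrow> finite (cells W)"
  unfolding subgraph_def cells_def
  by (rule finite_subset[of _ "{..<n} \<times> {..<n}"]) (auto dest: nat_graph.sym nat_graph.lt)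

lemma finite_neighbours:
  assumes "subgraph W"
  shows "finite {z. W x z}"
proof (rule finite_subset)
  show "{z. W x z} \<subseteq> {..<n}" using assms lt[OF sym] by (auto simp: subgraph_def)
qed simp

lemma finite_missing [simp]: "finite (missing W P a)"
  unfolding missing_def by auto

lemma finite_improved [simp]: "finite (improved W s P a)"
  unfolding improved_def by auto

context
  fixes W s v P
  assumes W: "subgraph W" and s: "s \<in> S" and P: "shortest_path s v P"
begin

lemma s_lt: "s < n" using s S_lt by auto

lemma E_graph: "nat_graph n E" by unfold_locales

lemma W_graph: "nat_graph n W" using W by (simp add: subgraph_def)

lemma W_E: "W x y \<Longrightarrow> E x y" using W by (simp add: subgraph_def)

section \<open>Counting along a shortest path\<close>

lemma P_dist: "i \<le> \<delta> E s v \<Longrightarrow> \<delta> E s (P i) = \<delta> E s v - i"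
proof (induction i)
  case 0
  then show ?case using P by (simp add: shortest_path_def)
next
  case (Suc i)
  then have "\<delta> E s (P (Suc i)) + 1 = \<delta> E s (P i)" using P by (auto simp: shortest_path_def)
  then show ?case using Suc by simp
qed

lemma L_lt: "\<delta> E s v < n"
  using P s_lt dist_cap_lt by (auto simp: shortest_path_def)

lemma P_last: "P (\<delta> E s v) = s"
proof -
  have *: "\<delta> E s (P (\<delta> E s v)) = 0" using P_dist by simp
  then have "(E ^^ 0) s (P (\<delta> E s v))"
    by (cases rule: dist_cap_cases[OF s_lt, of M "P (\<delta> E s v)"]) auto
  then show ?thesis by simp
qed

text \<open>Double counting of the pairs of an index \<open>i\<close> and a neighbour
  \<open>z\<close> of \<open>P i\<close>. Nodes of the path have different distances from
  \<open>s\<close>, and those adjacent to \<open>z\<close> differ from \<open>z\<close> by at most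
  one in distance, so each \<open>z\<close> is counted at most three times.\<close>

lemma neighbour_count:
  assumes "I \<subseteq> {..\<delta> E s v}" "\<And>i. i \<in> I \<Longrightarrow> d \<le> card {z. W (P i) z}"
  shows "d * card I \<le> 3 * card (\<Union>i\<in>I. {z. W (P i) z})"
proof -
  let ?U = "\<Union>i\<in>I. {z. W (P i) z}"
  have fI: "finite I" using assms(1) finite_subset by blast
  have fU: "finite ?U"
    by (rule finite_subset[of _ "{..<n}"]) (auto dest: nat_graph.sym[OF W_graph] nat_graph.lt[OF W_graph])
  have three: "card {i \<in> I. W (P i) z} \<le> 3" for z
  proof -
    have "{i \<in> I. W (P i) z} \<subseteq> {\<delta> E s v - 1 - \<delta> E s z..\<delta> E s v + 1 - \<delta> E s z}"
    proof safe
      fix i assume i: "i \<in> I" "W (P i) z"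
      then have le: "i \<le> \<delta> E s v" using assms(1) by auto
      have "E (P i) z" "E z (P i)" using i(2) W_E sym by auto
      then have "\<delta> E s z \<le> \<delta> E s (P i) + 1" "\<delta> E s (P i) \<le> \<delta> E s z + 1"
        using dist_cap_edge[OF s_lt] by auto
      with P_dist[OF le] le show "i \<in> {\<delta> E s v - 1 - \<delta> E s z..\<delta> E s v + 1 - \<delta> E s z}" by auto
    qed
    from card_mono[OF _ this]
    have "card {i \<in> I. W (P i) z} \<le> card {\<delta> E s v - 1 - \<delta> E s z..\<delta> E s v + 1 - \<delta> E s z}" by simp
    also have "\<dots> \<le> 3" by (simp; linarith)
    finally show ?thesis .
  qed
  have "d * card I = (\<Sum>i\<in>I. d)" by simp
  also have "\<dots> \<le> (\<Sum>i\<in>I. card {z. W (P i) z})" by (rule sum_mono) (use assms in auto)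
  also have "\<dots> = (\<Sum>i\<in>I. card {z \<in> ?U. W (P i) z})"
    by (rule sum.cong) (auto intro!: arg_cong[of _ _ card])
  also have "\<dots> = (\<Sum>z\<in>?U. card {i \<in> I. W (P i) z})"
    by (rule sum_multicount_gen) (use fI fU in auto)
  also have "\<dots> \<le> (\<Sum>z\<in>?U. 3)" by (rule sum_mono) (rule three)
  finally show ?thesis by (simp add: mult.commute)
qed

lemma missing_dense:
  assumes dense: "dense d W" and "i \<in> missing W P (\<delta> E s v)"
  shows "d \<le> card {z. W (P i) z}"
proof -
  have "E (P i) (P (Suc i))" using assms(2) P sym by (auto simp: missing_def shortest_path_def)
  then show ?thesis using assms dense by (auto simp: missing_def dense_def)
qed

text \<open>The endpoints of missing edges have at least \<open>d\<close> neighbours in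
  \<open>W\<close>, and their neighbourhoods together contain at most \<open>n\<close>
  nodes.\<close>

lemma missing_bound:
  assumes "dense d W"
  shows "d * card (missing W P (\<delta> E s v)) \<le> 3 * n"
proof -
  let ?I = "missing W P (\<delta> E s v)"
  have "d * card ?I \<le> 3 * card (\<Union>i\<in>?I. {z. W (P i) z})"
    by (rule neighbour_count) (use missing_dense[OF assms] in \<open>auto simp: missing_def\<close>)
  also have "card (\<Union>i\<in>?I. {z. W (P i) z}) \<le> card {..<n}"
    by (rule card_mono) (auto dest: nat_graph.sym[OF W_graph] nat_graph.lt[OF W_graph])
  finally show ?thesis by simp
qed

section \<open>Rerouting and the existence of an affordable segment\<close>

lemma dist_along:
  assumes "nat_graph n X" "i \<le> a"
    and "\<And>j. i \<le> j \<Longrightarrow> j < a \<Longrightarrow> X (P (Suc j)) (P j)"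
  shows "\<delta> X s (P i) \<le> \<delta> X s (P a) + (a - i)"
  using assms(2,3)
proof (induction rule: inc_induct)
  case (step j)
  have "\<delta> X s (P j) \<le> \<delta> X s (P (Suc j)) + 1"
    using nat_graph.dist_cap_edge[OF assms(1) s_lt] step by simp
  moreover have "\<delta> X s (P (Suc j)) \<le> \<delta> X s (P a) + (a - Suc j)" using step by simp
  ultimately show ?case using step.hyps by simp
qed simp

text \<open>Take the missing unimproved edge nearest to \<open>v\<close>, that is, the least such
  index \<open>l\<close>. All missing edges between it and \<open>v\<close> are improved, which
  gives the count; failing the test in \<open>improved\<close> bounds the detour of
  \<open>P l\<close>.\<close>

lemma reroute:
  assumes "a \<le> \<delta> E s v" "card (improved W s P a) < card (missing W P a)"
  obtains l where "l < a" "\<delta> W s (P l) + \<delta> E s (P a) \<le> \<delta> E s (P l) + \<delta> W s (P a) + 2"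
    "card (missing W P l) \<le> card (improved W s P a)"
proof -
  have "\<exists>l. l \<in> missing W P a - improved W s P a"
    using assms(2) card_mono[of "improved W s P a" "missing W P a"] by fastforce
  then obtain l where l: "l \<in> missing W P a - improved W s P a"
    and least: "\<And>j. j < l \<Longrightarrow> j \<notin> missing W P a - improved W s P a"
    using exists_least_iff[of "\<lambda>l. l \<in> missing W P a - improved W s P a"] by auto
  have "missing W P l \<subseteq> improved W s P a"
    using l least by (auto simp: missing_def)
  then have "card (missing W P l) \<le> card (improved W s P a)" by (simp add: card_mono)
  with l that show ?thesis by (auto simp: missing_def improved_def not_less)
qed

text \<open>As long as nothing is affordable, rerouting through the last unimproved node multiplies the
  number of missing edges by less than \<open>1 / (q + 1)\<close> and lengthens the detour by \<open>2\<close>.  After \<open>k\<close>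
  rounds no missing edge is left.\<close>

lemma exists_affordable:
  assumes far: "\<delta> E s v + k + k < \<delta> W s v"
    and q: "card (missing W P (\<delta> E s v)) < (q + 1) ^ k"
  shows "\<exists>a\<le>\<delta> E s v. affordable W s P q a"
proof (rule ccontr)
  assume none: "\<not> ?thesis"
  have "\<exists>a\<le>\<delta> E s v. \<delta> W s (P a) \<le> \<delta> E s (P a) + i + i \<and>
      (q + 1) ^ i * card (missing W P a) \<le> card (missing W P (\<delta> E s v))" if "i \<le> k" for i
    using that
  proof (induction i)
    case 0
    \<comment> \<open>The rounds start at \<open>s\<close> itself, which has the largest index on
      the path and detour \<open>0\<close>.\<close>
    show ?case using P_last by (intro exI[of _ "\<delta> E s v"]) simp
  next
    case (Suc i)
    then obtain a where a: "a \<le> \<delta> E s v" "\<delta> W s (P a) \<le> \<delta> E s (P a) + i + i"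
      "(q + 1) ^ i * card (missing W P a) \<le> card (missing W P (\<delta> E s v))" by auto
    have "\<not> affordable W s P q a" using none a(1) by auto
    then have lt: "(q + 1) * card (improved W s P a) < card (missing W P a)"
      using a(2) Suc.prems by (auto simp: affordable_def)
    then have "card (improved W s P a) < card (missing W P a)"
      by (rule le_less_trans[rotated]) simp
    with a(1) obtain l where l: "l < a"
      "\<delta> W s (P l) + \<delta> E s (P a) \<le> \<delta> E s (P l) + \<delta> W s (P a) + 2"
      "card (missing W P l) \<le> card (improved W s P a)" by (rule reroute)
    have "(q + 1) ^ Suc i * card (missing W P l) \<le> (q + 1) ^ i * ((q + 1) * card (improved W s P a))"
      using l(3) by (simp only: power_Suc2 mult.assoc) (intro mult_le_mono2)
    also have "\<dots> \<le> (q + 1) ^ i * card (missing W P a)" using lt by (intro mult_le_mono2) simp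
    finally have "(q + 1) ^ Suc i * card (missing W P l) \<le> card (missing W P (\<delta> E s v))"
      using a(3) by simp
    then show ?case using l(1,2) a(1,2) by (intro exI[of _ l]) auto
  qed
  from this[of k] obtain a where a: "a \<le> \<delta> E s v" "\<delta> W s (P a) \<le> \<delta> E s (P a) + k + k"
    "(q + 1) ^ k * card (missing W P a) \<le> card (missing W P (\<delta> E s v))" by auto
  \<comment> \<open>A nonempty set would make the left side of the last inequality at least
    \<open>(q + 1) ^ k\<close>, against the assumption on \<open>q\<close>. So \<open>W\<close>
    contains the whole segment, and the detour of \<open>v\<close> is at most that of
    \<open>P a\<close>.\<close>
  have "card (missing W P a) = 0"
    using a(3) q by (cases "card (missing W P a)") auto
  then have *: "W (P j) (P (Suc j))" if "j < a" for j using that by (auto simp: missing_def)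
  have "\<delta> W s (P 0) \<le> \<delta> W s (P a) + (a - 0)"
    using dist_along[OF W_graph, of 0] * nat_graph.sym[OF W_graph] by blast
  moreover have "P 0 = v" using P by (simp add: shortest_path_def)
  ultimately show False using a far P_dist[OF a(1)] by simp
qed

section \<open>Effect of a purchase on distances, size and potential\<close>

context
  fixes q a
  assumes a: "a \<le> \<delta> E s v" and aff: "affordable W s P q a"
begin

lemma subgraph_buy: "subgraph (buy W P a)"
proof -
  have "buy W P a x y \<Longrightarrow> E x y" for x y
    using a P sym W_E by (auto simp: buy_def shortest_path_def)
  moreover have "buy W P a x y \<Longrightarrow> buy W P a y x" for x y
    using nat_graph.sym[OF W_graph] by (auto simp: buy_def)
  ultimately show ?thesis unfolding subgraph_def nat_graph_def using lt by blast
qed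

lemma buy_graph: "nat_graph n (buy W P a)"
  using subgraph_buy by (simp add: subgraph_def)

lemma buy_dist_le: "\<delta> (buy W P a) s z \<le> \<delta> W s z"
  by (rule dist_cap_antimono[OF W_graph buy_graph s_lt]) (auto simp: buy_def)

text \<open>The bought edges lead from \<open>P a\<close> to \<open>P i\<close> as fast as
  \<open>E\<close> does, so the detour does not grow on the way.\<close>

lemma buy_dist:
  assumes "i \<le> a"
  shows "\<delta> (buy W P a) s (P i) + \<delta> E s (P a) \<le> \<delta> E s (P i) + \<delta> W s (P a)"
proof -
  have "\<delta> (buy W P a) s (P i) \<le> \<delta> (buy W P a) s (P a) + (a - i)"
    by (rule dist_along[OF buy_graph assms]) (auto simp: buy_def)
  then show ?thesis using buy_dist_le[of "P a"] P_dist[OF a] P_dist[of i] a assms by auto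
qed

lemma buy_near: "\<delta> (buy W P a) s v \<le> \<delta> E s v + k + k"
proof -
  have "P 0 = v" using P by (simp add: shortest_path_def)
  then show ?thesis using buy_dist[of 0] aff by (auto simp: affordable_def)
qed

lemma buy_cells: "card (cells (buy W P a)) \<le> card (cells W) + 2 * card (missing W P a)"
proof -
  have "cells (buy W P a) \<subseteq> cells W \<union> ((\<lambda>i. (P i, P (Suc i))) ` missing W P a
      \<union> (\<lambda>i. (P (Suc i), P i)) ` missing W P a)"
    using nat_graph.sym[OF W_graph] by (auto simp: cells_def buy_def missing_def)
  then have "card (cells (buy W P a)) \<le> card (cells W \<union> ((\<lambda>i. (P i, P (Suc i))) ` missing W P a
      \<union> (\<lambda>i. (P (Suc i), P i)) ` missing W P a))"
    by (intro card_mono) (auto simp: finite_cells[OF W])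
  also have "\<dots> \<le> card (cells W) + (card (missing W P a) + card (missing W P a))"
    by (intro order_trans[OF card_Un_le] add_mono card_image_le order_refl) auto
  finally show ?thesis by simp
qed

text \<open>Every \<open>W\<close>-neighbour of an improved node loses at least one unit of
  potential in the row of \<open>s\<close>, and no other entry grows. By
  \<open>neighbour_count\<close> there are at least \<open>d / 3\<close> such neighbours per
  improved node.\<close>

lemma buy_pot:
  assumes dense: "dense d W"
  shows "d * card (improved W s P a) \<le> 3 * (pot W - pot (buy W P a))"
    and "pot (buy W P a) \<le> pot W"
proof -
  let ?I = "improved W s P a" and ?W' = "buy W P a"
  let ?U = "\<Union>i\<in>?I. {z. W (P i) z}"
  let ?f = "\<lambda>W s z. min (\<delta> W s z - \<delta> E s z) (2 * k + 3)"
  have U: "?U \<subseteq> {..<n}"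
    by (auto dest: nat_graph.sym[OF W_graph] nat_graph.lt[OF W_graph])
  \<comment> \<open>The slack of \<open>2\<close> in \<open>improved\<close> pays for passing
    between \<open>P i\<close> and \<open>z\<close> once in \<open>W\<close> and once in the new
    graph. The new detour of \<open>z\<close> is at most \<open>2 * k + 2\<close>, hence below the
    cap.\<close>
  have step: "?f ?W' s z + 1 \<le> ?f W s z" if z: "z \<in> ?U" for z
  proof -
    obtain i where i: "i < a" "W (P i) z" "\<delta> E s (P i) + \<delta> W s (P a) + 2 < \<delta> W s (P i) + \<delta> E s (P a)"
      using z by (auto simp: improved_def missing_def)
    have zi: "W z (P i)" "E z (P i)" "E (P i) z" "?W' (P i) z"
      using i(2) nat_graph.sym[OF W_graph] W_E by (auto simp: buy_def)
    have "\<delta> W s (P i) \<le> \<delta> W s z + 1"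
      using nat_graph.dist_cap_edge[OF W_graph s_lt _ zi(1)] by simp
    moreover have "\<delta> ?W' s z \<le> \<delta> ?W' s (P i) + 1"
      using nat_graph.dist_cap_edge[OF buy_graph s_lt _ zi(4)] by simp
    moreover have "\<delta> E s (P i) \<le> \<delta> E s z + 1" using dist_cap_edge[OF s_lt _ zi(2)] by simp
    moreover have "\<delta> E s z \<le> \<delta> ?W' s z"
      by (rule dist_cap_antimono[OF buy_graph E_graph s_lt]) (use subgraph_buy in \<open>auto simp: subgraph_def\<close>)
    ultimately show ?thesis using i(1,3) buy_dist[of i] aff by (auto simp: affordable_def)
  qed
  have mono: "?f ?W' s' z \<le> ?f W s' z" if "s' \<in> S" for s' z
  proof -
    have "\<delta> ?W' s' z \<le> \<delta> W s' z"
      by (rule dist_cap_antimono[OF W_graph buy_graph]) (use that S_lt in \<open>auto simp: buy_def\<close>)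
    then show ?thesis by linarith
  qed
  have fS: "finite S" using S_lt finite_subset by blast
  have "(\<Sum>z<n. ?f ?W' s z) + card ?U = (\<Sum>z<n. ?f ?W' s z + (if z \<in> ?U then 1 else 0))"
    using U by (simp only: sum.distrib sum.If_cases[OF finite_lessThan] Int_absorb1 Collect_mem_eq) simp
  also have "\<dots> \<le> (\<Sum>z<n. ?f W s z)"
    by (rule sum_mono) (use step mono[OF s] in auto)
  finally have row: "(\<Sum>z<n. ?f ?W' s z) + card ?U \<le> (\<Sum>z<n. ?f W s z)" .
  have "pot ?W' + card ?U = (\<Sum>z<n. ?f ?W' s z) + card ?U + (\<Sum>s'\<in>S - {s}. \<Sum>z<n. ?f ?W' s' z)"
    unfolding pot_def using sum.remove[OF fS s, of "\<lambda>s. \<Sum>z<n. ?f ?W' s z"] by simp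
  also have "\<dots> \<le> (\<Sum>z<n. ?f W s z) + (\<Sum>s'\<in>S - {s}. \<Sum>z<n. ?f W s' z)"
    by (intro add_mono row sum_mono mono) auto
  also have "\<dots> = pot W"
    unfolding pot_def using sum.remove[OF fS s, of "\<lambda>s. \<Sum>z<n. ?f W s z"] by simp
  finally have p: "pot ?W' + card ?U \<le> pot W" .
  have "d * card ?I \<le> 3 * card ?U"
    by (rule neighbour_count) (use missing_dense[OF dense] a in \<open>auto simp: improved_def missing_def\<close>)
  with p show "d * card ?I \<le> 3 * (pot W - pot ?W')" "pot ?W' \<le> pot W" by auto
qed

end

text \<open>The factor \<open>6\<close> is two cells per edge times the \<open>3\<close> of
  \<open>buy_pot\<close>. Here \<open>q\<^sub>0\<close> is what the machine finds, whereas
  \<open>q\<close> is any value for which \<open>exists_affordable\<close> guarantees success;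
  minimality gives \<open>q\<^sub>0 \<le> q\<close>, so the bound holds for all such
  \<open>q\<close> at once.\<close>

lemma buy_amortized:
  assumes dense: "dense d W" and far: "\<delta> E s v + k + k < \<delta> W s v"
    and a: "a \<le> \<delta> E s v" and aff: "affordable W s P q\<^sub>0 a"
    and least: "\<And>q b. q < q\<^sub>0 \<Longrightarrow> b \<le> \<delta> E s v \<Longrightarrow> \<not> affordable W s P q b"
    and q: "3 * n < d * (q + 1) ^ k"
  shows "d * card (cells (buy W P a)) + 6 * (q + 1) * pot (buy W P a)
    \<le> d * card (cells W) + 6 * (q + 1) * pot W"
proof -
  let ?m = "card (missing W P (\<delta> E s v))"
  have "d * ?m < d * (q + 1) ^ k" using missing_bound[OF dense] q by linarith
  then have "?m < (q + 1) ^ k" by simp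
  from exists_affordable[OF far this] least have "q\<^sub>0 \<le> q" using not_less by blast
  have "d * card (missing W P a) \<le> d * ((q\<^sub>0 + 1) * card (improved W s P a))"
    using aff by (auto simp: affordable_def)
  also have "\<dots> \<le> d * ((q + 1) * card (improved W s P a))"
    using \<open>q\<^sub>0 \<le> q\<close> by (intro mult_le_mono) auto
  also have "\<dots> = (q + 1) * (d * card (improved W s P a))" by (simp only: mult.left_commute)
  also have "\<dots> \<le> (q + 1) * (3 * (pot W - pot (buy W P a)))"
    using buy_pot(1)[OF a aff dense] by (intro mult_le_mono2)
  finally have *: "d * card (missing W P a) \<le> (q + 1) * (3 * (pot W - pot (buy W P a)))" .
  have "d * card (cells (buy W P a)) \<le> d * (card (cells W) + 2 * card (missing W P a))"
    using buy_cells[OF a aff] by (intro mult_le_mono2)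
  also have "\<dots> = d * card (cells W) + 2 * (d * card (missing W P a))" by (simp add: algebra_simps)
  also have "\<dots> \<le> d * card (cells W) + 6 * (q + 1) * (pot W - pot (buy W P a))"
    using * by (simp add: algebra_simps)
  finally have "d * card (cells (buy W P a)) + 6 * (q + 1) * pot (buy W P a) \<le>
    d * card (cells W) + 6 * (q + 1) * ((pot W - pot (buy W P a)) + pot (buy W P a))"
    by (simp add: algebra_simps)
  then show ?thesis using buy_pot(2)[OF a aff dense] by simp
qed

end
end


section \<open>Shortest paths on the machine\<close>

abbreviation Var :: "vname \<Rightarrow> aexp" where "Var x \<equiv> Cell x (Num 0) (Num 0)"
abbreviation Arr :: "vname \<Rightarrow> aexp \<Rightarrow> aexp" where "Arr x i \<equiv> Cell x i (Num 0)"
abbreviation LSet :: "vname \<Rightarrow> aexp \<Rightarrow> lcom" where "LSet x e \<equiv> LAssign x (Num 0) (Num 0) e"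
abbreviation LSetArr :: "vname \<Rightarrow> aexp \<Rightarrow> aexp \<Rightarrow> lcom" where "LSetArr x i e \<equiv> LAssign x i (Num 0) e"
notation LSeq (infixr \<open>;;\<close> 60)

definition adj :: "nat \<Rightarrow> (nat \<Rightarrow> nat \<Rightarrow> nat) \<Rightarrow> nat \<Rightarrow> nat \<Rightarrow> bool" where
  "adj n X x y \<longleftrightarrow> x < n \<and> y < n \<and> 0 < X x y"

definition relax :: "vname \<Rightarrow> vname \<Rightarrow> lcom" where
  "relax X Y = LFor ''u'' (LFor ''x''
     (LIf (And (Less (Num 0) (Cell X (Var ''u'') (Var ''x'')))
               (Less (Plus (Arr Y (Var ''u'')) (Num 1)) (Arr Y (Var ''x''))))
       (LSetArr Y (Var ''x'') (Plus (Arr Y (Var ''u'')) (Num 1)))))"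

definition bellman_ford :: "vname \<Rightarrow> vname \<Rightarrow> lcom" where
  "bellman_ford X Y =
     LFor ''u'' (LSetArr Y (Var ''u'') (Var ''M'')) ;;
     LSetArr Y (Var ''s'') (Num 0) ;;
     LFor ''r'' (relax X Y)"

lemma writes_relax: "writes (relax X Y) = {''u'', ''x'', Y}"
  by (auto simp: relax_def)

lemma writes_bellman_ford: "writes (bellman_ford X Y) = {''u'', ''x'', ''r'', Y}"
  by (auto simp: bellman_ford_def relax_def)

text \<open>Updates happen in place, so a round may already use values lowered in the same round.
  These are still lengths of walks and only smaller, so the round achieves at least as much as a
  simultaneous update.\<close>

lemma relax_correct:
  fixes \<sigma> :: state
  assumes XY: "X \<notin> {''u'', ''x'', Y}" "Y \<notin> {''u'', ''x''}"
    and A: "A = adj n (\<sigma> X)"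
    and sound: "\<forall>v<n. \<sigma> Y v 0 \<le> M \<and> (\<sigma> Y v 0 < M \<longrightarrow> (A ^^ \<sigma> Y v 0) s v)"
  defines "\<tau> \<equiv> sem n (relax X Y) \<sigma>"
  shows "(\<forall>v<n. \<tau> Y v 0 \<le> M \<and> (\<tau> Y v 0 < M \<longrightarrow> (A ^^ \<tau> Y v 0) s v)) \<and>
    (\<forall>v<n. \<tau> Y v 0 \<le> \<sigma> Y v 0) \<and> (\<forall>u v. A u v \<longrightarrow> \<tau> Y v 0 \<le> \<sigma> Y u 0 + 1)"
proof -
  let ?c = "LIf (And (Less (Num 0) (Cell X (Var ''u'') (Var ''x'')))
               (Less (Plus (Arr Y (Var ''u'')) (Num 1)) (Arr Y (Var ''x''))))
       (LSetArr Y (Var ''x'') (Plus (Arr Y (Var ''u'')) (Num 1)))"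
  let ?sound = "\<lambda>\<tau> :: state. \<forall>v<n. \<tau> Y v 0 \<le> M \<and> (\<tau> Y v 0 < M \<longrightarrow> (A ^^ \<tau> Y v 0) s v)"
  let ?I = "\<lambda>j \<tau> :: state. ?sound \<tau> \<and> (\<forall>v<n. \<tau> Y v 0 \<le> \<sigma> Y v 0) \<and>
    (\<forall>u<j. \<forall>v. A u v \<longrightarrow> \<tau> Y v 0 \<le> \<sigma> Y u 0 + 1)"
  have "?I n (sem n (relax X Y) \<sigma>)"
    unfolding relax_def
  proof (rule sem_For_invariant[where I = ?I])
    show "?I 0 \<sigma>" using sound by simp
    show "?I n (upd \<tau> ''u'' 0 0 n)" if "?I n \<tau>" for \<tau>
      using that XY by (auto simp: upd_apply)
  next
    fix j \<tau>
    assume j: "j < n" and I: "?I j \<tau>"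
      and "\<And>y. y \<notin> insert ''u'' (writes (LFor ''x'' ?c)) \<Longrightarrow> \<tau> y = \<sigma> y"
    then have X1: "\<tau> X = \<sigma> X" using XY by auto
    let ?J = "\<lambda>i \<rho> :: state. ?I j \<rho> \<and> (\<forall>v<i. A j v \<longrightarrow> \<rho> Y v 0 \<le> \<sigma> Y j 0 + 1)"
    have "?J n (sem n (LFor ''x'' ?c) (upd \<tau> ''u'' 0 0 j))"
    proof (rule sem_For_invariant[where I = ?J])
      show "?J 0 (upd \<tau> ''u'' 0 0 j)" using I XY by (auto simp: upd_apply)
      show "?J n (upd \<tau> ''x'' 0 0 n)" if "?J n \<tau>" for \<tau>
        using that XY by (auto simp: upd_apply)
    next
      fix i \<rho>
      assume i: "i < n" and J: "?J i \<rho>"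
        and fr: "\<And>y. y \<notin> insert ''x'' (writes ?c) \<Longrightarrow> \<rho> y = upd \<tau> ''u'' 0 0 j y"
      have \<rho>: "\<rho> X = \<sigma> X" "\<rho> ''u'' 0 0 = j" using fr X1 XY by auto
      have ji: "(0 < \<sigma> X j i) = A j i" using A i j by (simp add: adj_def)
      show "?J (Suc i) (sem n ?c (upd \<rho> ''x'' 0 0 i))"
      proof (cases "A j i \<and> \<rho> Y j 0 + 1 < \<rho> Y i 0")
        case True
        \<comment> \<open>The test is strict and no entry exceeds \<open>M\<close>, so the entry of
          \<open>j\<close> is below \<open>M\<close> and belongs to a real walk.\<close>
        have "\<rho> Y j 0 + 1 < M" using J True i by (meson less_le_trans)
        then have "(A ^^ \<rho> Y j 0) s j" using J j by auto
        then have walk: "(A ^^ Suc (\<rho> Y j 0)) s i" using True by auto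
        have *: "sem n ?c (upd \<rho> ''x'' 0 0 i)
          = upd (upd \<rho> ''x'' 0 0 i) Y i 0 (\<rho> Y j 0 + 1)"
          using True \<rho> ji XY by simp
        have le: "\<rho> Y j 0 \<le> \<sigma> Y j 0" "\<rho> Y i 0 \<le> \<sigma> Y i 0" using J i j by auto
        have new: "upd (upd \<rho> ''x'' 0 0 i) Y i 0 (\<rho> Y j 0 + 1) Y v 0 =
            (if v = i then \<rho> Y j 0 + 1 else \<rho> Y v 0)" for v
          using XY by (auto simp: upd_apply)
        have "\<rho> Y j 0 + 1 \<le> \<sigma> Y u 0 + 1" if "u < j" "A u i" for u
          using J that True by (meson le_trans less_imp_le)
        then show ?thesis unfolding * new
          using J True walk le \<open>\<rho> Y j 0 + 1 < M\<close> by (auto simp: less_Suc_eq)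
      next
        case False
        then have *: "sem n ?c (upd \<rho> ''x'' 0 0 i)
          = upd \<rho> ''x'' 0 0 i"
          using \<rho> ji XY by auto
        have new: "upd \<rho> ''x'' 0 0 i Y v 0 = \<rho> Y v 0" for v using XY by simp
        have "\<rho> Y i 0 \<le> \<sigma> Y j 0 + 1" if "A j i"
        proof -
          have "\<rho> Y i 0 \<le> \<rho> Y j 0 + 1" using that False by simp
          also have "\<rho> Y j 0 \<le> \<sigma> Y j 0" using J j by auto
          finally show ?thesis by simp
        qed
        then show ?thesis unfolding * new using J by (auto simp: less_Suc_eq)
      qed
    qed
    then show "?I (Suc j) (sem n (LFor ''x'' ?c) (upd \<tau> ''u'' 0 0 j))"
      using A by (auto simp: less_Suc_eq adj_def)
  qed
  then show ?thesis unfolding \<tau>_def using A by (auto simp: adj_def)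
qed

text \<open>After \<open>r\<close> rounds an entry is at most the length of any walk of up to
  \<open>r\<close> edges to its node, and entries below \<open>M\<close> are lengths of walks
  throughout. Finite distances are below \<open>n\<close>, so \<open>n\<close> rounds
  suffice.\<close>

lemma bellman_ford_correct:
  fixes \<sigma> :: state
  assumes XY: "X \<notin> {''u'', ''x'', ''r'', Y}" "Y \<notin> {''u'', ''x'', ''r'', ''s'', ''M''}"
    and A: "nat_graph n (adj n (\<sigma> X))"
    and s: "\<sigma> ''s'' 0 0 = s" "s < n" and M: "\<sigma> ''M'' 0 0 = M" "n \<le> M" and v: "v < n"
  shows "sem n (bellman_ford X Y) \<sigma> Y v 0 = dist_cap M (adj n (\<sigma> X)) s v"
proof -
  let ?A = "adj n (\<sigma> X)"
  define \<sigma>1 where "\<sigma>1 = sem n (LFor ''u'' (LSetArr Y (Var ''u'') (Var ''M''))) \<sigma>"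
  define \<sigma>2 where "\<sigma>2 = sem n (LSetArr Y (Var ''s'') (Num 0)) \<sigma>1"
  have 1: "\<forall>v<n. \<sigma>1 Y v 0 = M" unfolding \<sigma>1_def
    by (rule sem_For_invariant[where I = "\<lambda>j \<tau>. \<forall>v<j. \<tau> Y v 0 = M"])
      (use XY M in \<open>auto simp: upd_apply less_Suc_eq\<close>)
  have fr1: "\<sigma>1 y = \<sigma> y" if "y \<notin> {''u'', Y}" for y
    unfolding \<sigma>1_def by (rule sem_frame) (use that in auto)
  have 2: "\<sigma>2 Y v 0 = (if v = s then 0 else M)" if "v < n" for v
    unfolding \<sigma>2_def using 1 s that XY fr1 by (auto simp: upd_apply)
  have X2: "\<sigma>2 X = \<sigma> X" unfolding \<sigma>2_def using fr1 XY by auto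
  let ?sound = "\<lambda>\<tau> :: state. \<forall>v<n. \<tau> Y v 0 \<le> M \<and> (\<tau> Y v 0 < M \<longrightarrow> (?A ^^ \<tau> Y v 0) s v)"
  let ?I = "\<lambda>r \<tau> :: state. ?sound \<tau> \<and> (\<forall>l\<le>r. \<forall>v. (?A ^^ l) s v \<longrightarrow> \<tau> Y v 0 \<le> l)"
  have I: "?I n (sem n (LFor ''r'' (relax X Y)) \<sigma>2)"
  proof (rule sem_For_invariant[where I = ?I])
    show "?I 0 \<sigma>2" using 2 s M by auto
    show "?I n (upd \<tau> ''r'' 0 0 n)" if "?I n \<tau>" for \<tau>
      using that XY by auto
  next
    fix r \<tau>
    assume r: "r < n" and I: "?I r \<tau>"
      and fr: "\<And>y. y \<notin> insert ''r'' (writes (relax X Y)) \<Longrightarrow> \<tau> y = \<sigma>2 y"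
    have X: "upd \<tau> ''r'' 0 0 r X = \<sigma> X" using fr X2 XY by (simp add: writes_relax)
    have Y: "upd \<tau> ''r'' 0 0 r Y = \<tau> Y" using XY by simp
    let ?\<tau> = "sem n (relax X Y) (upd \<tau> ''r'' 0 0 r)"
    have R: "?sound ?\<tau> \<and> (\<forall>v<n. ?\<tau> Y v 0 \<le> \<tau> Y v 0) \<and> (\<forall>u v. ?A u v \<longrightarrow> ?\<tau> Y v 0 \<le> \<tau> Y u 0 + 1)"
      using relax_correct[of X Y ?A n "upd \<tau> ''r'' 0 0 r" M s] XY X Y I by auto
    have "?\<tau> Y v 0 \<le> l" if l: "l \<le> Suc r" "(?A ^^ l) s v" for l v
    proof (cases l)
      case 0
      then have "\<tau> Y v 0 \<le> 0" "v < n" using I l s by auto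
      then show ?thesis using R 0 by fastforce
    next
      case (Suc l')
      then obtain u where u: "(?A ^^ l') s u" "?A u v" using l by auto
      have "?\<tau> Y v 0 \<le> \<tau> Y u 0 + 1" using R u by auto
      also have "\<tau> Y u 0 \<le> l'" using I u Suc l by auto
      finally show ?thesis using Suc by simp
    qed
    then show "?I (Suc r) ?\<tau>" using R by blast
  qed
  have eq: "sem n (bellman_ford X Y) \<sigma> = sem n (LFor ''r'' (relax X Y)) \<sigma>2"
    by (simp add: bellman_ford_def \<sigma>1_def \<sigma>2_def)
  show ?thesis
    unfolding eq
  proof (cases rule: nat_graph.dist_cap_cases[OF A s(2) M(2), of v])
    case 1
    then show "sem n (LFor ''r'' (relax X Y)) \<sigma>2 Y v 0 = dist_cap M ?A s v" using I v
      by (metis le_neq_implies_less)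
  next
    case 2
    then have le: "sem n (LFor ''r'' (relax X Y)) \<sigma>2 Y v 0 \<le> dist_cap M ?A s v" using I by auto
    then have "sem n (LFor ''r'' (relax X Y)) \<sigma>2 Y v 0 < M" using 2 M by linarith
    then have "(?A ^^ sem n (LFor ''r'' (relax X Y)) \<sigma>2 Y v 0) s v" using I v by blast
    then show "sem n (LFor ''r'' (relax X Y)) \<sigma>2 Y v 0 = dist_cap M ?A s v"
      using le dist_cap_le le_antisym by metis
  qed
qed


section \<open>Treating one pair\<close>

definition backtrack :: lcom where
  "backtrack = LSetArr ''P'' (Num 0) (Var ''v'') ;;
     LFor ''i'' (LIf (Less (Var ''i'') (Arr ''G'' (Var ''v'')))
       (LFor ''x'' (LIf (And (Less (Num 0) (Cell ''E'' (Var ''x'') (Arr ''P'' (Var ''i''))))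
                             (Eq (Plus (Arr ''G'' (Var ''x'')) (Num 1)) (Arr ''G'' (Arr ''P'' (Var ''i'')))))
         (LSetArr ''P'' (Plus (Var ''i'') (Num 1)) (Var ''x'')))))"

text \<open>In the absence of multiplication, \<open>w\<close> accumulates the product of
  \<open>q + 1\<close> and the number of improved nodes by repeated addition.\<close>

definition count_path :: lcom where
  "count_path = LSet ''c'' (Num 0) ;; LSet ''w'' (Num 0) ;;
     LFor ''i'' (LIf (And (Less (Var ''i'') (Var ''a''))
         (Eq (Cell ''W'' (Arr ''P'' (Var ''i'')) (Arr ''P'' (Plus (Var ''i'') (Num 1)))) (Num 0)))
       (LSet ''c'' (Plus (Var ''c'') (Num 1)) ;;
        LIf (Less (Plus (Plus (Arr ''G'' (Arr ''P'' (Var ''i''))) (Arr ''D'' (Arr ''P'' (Var ''a'')))) (Num 2))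
                  (Plus (Arr ''D'' (Arr ''P'' (Var ''i''))) (Arr ''G'' (Arr ''P'' (Var ''a'')))))
          (LSet ''w'' (Plus (Var ''w'') (Plus (Var ''q'') (Num 1))))))"

text \<open>Loops cannot be left early, so the flag \<open>F\<close> protects the first hit. With
  \<open>q\<close> in the outer loop this hit has the least possible \<open>q\<close>.\<close>

definition search :: lcom where
  "search = LSet ''F'' (Num 0) ;;
     LFor ''q'' (LFor ''a'' (LIf (Not (Less (Arr ''G'' (Var ''v'')) (Var ''a'')))
       (count_path ;;
        LIf (And (Eq (Var ''F'') (Num 0))
              (And (Not (Less (Plus (Plus (Arr ''G'' (Arr ''P'' (Var ''a''))) (Var ''k'')) (Var ''k''))
                              (Arr ''D'' (Arr ''P'' (Var ''a'')))))
                   (Not (Less (Var ''w'') (Var ''c'')))))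
          (LSet ''F'' (Num 1) ;; LSet ''A'' (Var ''a'')))))"

definition purchase :: lcom where
  "purchase = LFor ''i'' (LIf (Less (Var ''i'') (Var ''A''))
     (LAssign ''W'' (Arr ''P'' (Var ''i'')) (Arr ''P'' (Plus (Var ''i'') (Num 1))) (Num 1) ;;
      LAssign ''W'' (Arr ''P'' (Plus (Var ''i'') (Num 1))) (Arr ''P'' (Var ''i'')) (Num 1)))"

definition process_pair :: lcom where
  "process_pair = bellman_ford ''E'' ''G'' ;; bellman_ford ''W'' ''D'' ;;
     LIf (And (Less (Num 0) (Arr ''S'' (Var ''s'')))
              (Less (Plus (Plus (Arr ''G'' (Var ''v'')) (Var ''k'')) (Var ''k'')) (Arr ''D'' (Var ''v''))))
       (backtrack ;; search ;; purchase)"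

lemma writes_backtrack: "writes backtrack = {''P'', ''i'', ''x''}"
  by (auto simp: backtrack_def)

lemma writes_count_path: "writes count_path = {''c'', ''w'', ''i''}"
  by (auto simp: count_path_def)

lemma writes_search: "writes search = {''F'', ''q'', ''a'', ''c'', ''w'', ''i'', ''A''}"
  by (auto simp: search_def writes_count_path)

lemma writes_purchase: "writes purchase = {''i'', ''W''}"
  by (auto simp: purchase_def)

lemma writes_process_pair: "writes process_pair =
    {''u'', ''x'', ''r'', ''G'', ''D'', ''P'', ''i'', ''F'', ''q'', ''a'', ''c'', ''w'', ''A'', ''W''}"
  by (auto simp: process_pair_def writes_bellman_ford writes_backtrack writes_search writes_purchase)

lemma upd_upd_swap: "upd (upd \<sigma> X a b m) X b a m X x y =
    (if (x = a \<and> y = b) \<or> (x = b \<and> y = a) then m else \<sigma> X x y)"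
  by (auto simp: upd_def)

lemma card_less_Suc_filter:
  "card {i. i < Suc j \<and> Q i} = card {i. i < j \<and> Q i} + (if Q j then 1 else 0)"
proof -
  have "{i. i < Suc j \<and> Q i} = (if Q j then insert j {i. i < j \<and> Q i} else {i. i < j \<and> Q i})"
    by (auto simp: less_Suc_eq)
  then show ?thesis by simp
qed

section \<open>Correctness of the search for a segment and of its purchase\<close>

context spanner_input
begin

lemma backtrack_correct:
  fixes \<sigma> :: state
  assumes E: "adj n (\<sigma> ''E'') = E" and v: "\<sigma> ''v'' 0 0 = v" "v < n" and s: "s < n"
    and G: "\<forall>x<n. \<sigma> ''G'' x 0 = \<delta> E s x" and reach: "\<exists>l. (E ^^ l) s v"
  shows "shortest_path s v (\<lambda>i. sem n backtrack \<sigma> ''P'' i 0)"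
proof -
  let ?L = "\<delta> E s v"
  let ?c = "LIf (And (Less (Num 0) (Cell ''E'' (Var ''x'') (Arr ''P'' (Var ''i''))))
                     (Eq (Plus (Arr ''G'' (Var ''x'')) (Num 1)) (Arr ''G'' (Arr ''P'' (Var ''i'')))))
         (LSetArr ''P'' (Plus (Var ''i'') (Num 1)) (Var ''x''))"
  let ?pred = "\<lambda>x y. E x y \<and> \<delta> E s x + 1 = \<delta> E s y"
  let ?I = "\<lambda>j \<tau> :: state. \<tau> ''P'' 0 0 = v \<and>
    (\<forall>i. i < j \<longrightarrow> i < ?L \<longrightarrow> ?pred (\<tau> ''P'' (Suc i) 0) (\<tau> ''P'' i 0))"
  have Ln: "?L < n" using reach s dist_cap_lt by auto
  have "?I n (sem n backtrack \<sigma>)"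
    unfolding backtrack_def sem.simps(2)
  proof (rule sem_For_invariant[where I = ?I])
    show "?I 0 (sem n (LSetArr ''P'' (Num 0) (Var ''v'')) \<sigma>)" using v by simp
    show "?I n (upd \<tau> ''i'' 0 0 n)" if "?I n \<tau>" for \<tau> using that by simp
  next
    fix j \<tau>
    assume j: "j < n" and I: "?I j \<tau>"
      and "\<And>y. y \<notin> insert ''i'' (writes (LIf (Less (Var ''i'') (Arr ''G'' (Var ''v''))) (LFor ''x'' ?c))) \<Longrightarrow>
        \<tau> y = sem n (LSetArr ''P'' (Num 0) (Var ''v'')) \<sigma> y"
    then have fr: "\<tau> ''E'' = \<sigma> ''E''" "\<tau> ''G'' = \<sigma> ''G''" "\<tau> ''v'' = \<sigma> ''v''" by auto
    let ?\<tau> = "upd \<tau> ''i'' 0 0 j"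
    show "?I (Suc j) (sem n (LIf (Less (Var ''i'') (Arr ''G'' (Var ''v''))) (LFor ''x'' ?c)) ?\<tau>)"
    proof (cases "j < ?L")
      case False
      then have "sem n (LIf (Less (Var ''i'') (Arr ''G'' (Var ''v''))) (LFor ''x'' ?c)) ?\<tau> = ?\<tau>"
        using fr v G by simp
      then show ?thesis using I False by (auto simp: less_Suc_eq)
    next
      case True
      then have eq: "sem n (LIf (Less (Var ''i'') (Arr ''G'' (Var ''v''))) (LFor ''x'' ?c)) ?\<tau>
          = sem n (LFor ''x'' ?c) ?\<tau>"
        using fr v G by simp
      let ?y = "\<tau> ''P'' j 0"
      \<comment> \<open>The nodes found so far lie at the distances \<open>?L\<close>,
        \<open>?L - 1\<close> and so on, so the current node \<open>?y\<close> is at positive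
        distance and has a predecessor.\<close>
      have "i \<le> j \<Longrightarrow> \<tau> ''P'' i 0 < n \<and> \<delta> E s (\<tau> ''P'' i 0) + i = ?L" for i
      proof (induction i)
        case 0
        show ?case using I v by simp
      next
        case (Suc i)
        then have "?pred (\<tau> ''P'' (Suc i) 0) (\<tau> ''P'' i 0)" using I True by auto
        then show ?case using Suc lt by auto
      qed
      then have y: "?y < n" "\<delta> E s ?y + j = ?L" by auto
      then have pos: "0 < \<delta> E s ?y" using True by linarith
      have "\<exists>l. (E ^^ l) s ?y"
        using y(2) Ln by (cases rule: dist_cap_cases[OF s, of M ?y]) auto
      then obtain u where u: "u < n" "?pred u ?y"
        using dist_cap_pred[OF s _ _ pos] by auto
      \<comment> \<open>Every predecessor that is met overwrites the entry and the last one remains;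
        any of them will do. The node \<open>u\<close> shows that there is one.\<close>
      let ?J = "\<lambda>m \<rho> :: state. (\<forall>i\<le>j. \<rho> ''P'' i 0 = \<tau> ''P'' i 0) \<and>
        ((\<exists>x<m. ?pred x ?y) \<longrightarrow> ?pred (\<rho> ''P'' (Suc j) 0) ?y)"
      have "?J n (sem n (LFor ''x'' ?c) ?\<tau>)"
      proof (rule sem_For_invariant[where I = ?J])
        show "?J 0 ?\<tau>" by simp
        show "?J n (upd \<rho> ''x'' 0 0 n)" if "?J n \<rho>" for \<rho> using that by simp
      next
        fix m \<rho>
        assume m: "m < n" and J: "?J m \<rho>"
          and "\<And>y. y \<notin> insert ''x'' (writes ?c) \<Longrightarrow> \<rho> y = ?\<tau> y"
        then have fr': "\<rho> ''E'' = \<sigma> ''E''" "\<rho> ''G'' = \<sigma> ''G''" "\<rho> ''i'' 0 0 = j" using fr by auto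
        have Py: "\<rho> ''P'' j 0 = ?y" using J by simp
        have "0 < \<sigma> ''E'' m ?y \<longleftrightarrow> E m ?y" using E m y by (auto simp: adj_def)
        then have "sem n ?c (upd \<rho> ''x'' 0 0 m) =
            (if ?pred m ?y then upd (upd \<rho> ''x'' 0 0 m) ''P'' (Suc j) 0 m else upd \<rho> ''x'' 0 0 m)"
          using fr' Py G m y by simp
        then show "?J (Suc m) (sem n ?c (upd \<rho> ''x'' 0 0 m))"
          using J by (auto simp: upd_apply less_Suc_eq)
      qed
      then have J: "\<forall>i\<le>j. sem n (LFor ''x'' ?c) ?\<tau> ''P'' i 0 = \<tau> ''P'' i 0"
        "?pred (sem n (LFor ''x'' ?c) ?\<tau> ''P'' (Suc j) 0) ?y" using u by blast+
      show ?thesis unfolding eq using I J by (auto simp: less_Suc_eq)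
    qed
  qed
  then show ?thesis using Ln reach by (auto simp: shortest_path_def)
qed

definition chosen where
  "chosen W s v P a \<longleftrightarrow> a \<le> \<delta> E s v \<and> (\<exists>q\<^sub>0. affordable W s P q\<^sub>0 a \<and>
     (\<forall>q<q\<^sub>0. \<forall>b\<le>\<delta> E s v. \<not> affordable W s P q b))"

context
  fixes \<sigma> :: state and W P s v
  assumes W: "subgraph W" and W_adj: "adj n (\<sigma> ''W'') = W"
    and s: "s \<in> S" and v: "\<sigma> ''v'' 0 0 = v" "v < n"
    and P: "shortest_path s v P" "\<forall>i. \<sigma> ''P'' i 0 = P i"
    and G: "\<forall>x<n. \<sigma> ''G'' x 0 = \<delta> E s x"
    and D: "\<forall>x<n. \<sigma> ''D'' x 0 = \<delta> W s x"
    and k_val: "\<sigma> ''k'' 0 0 = k"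
begin

lemma count_path_correct:
  assumes fr: "\<And>x. x \<in> {''W'', ''G'', ''D'', ''P''} \<Longrightarrow> \<tau> x = \<sigma> x"
    and a: "\<tau> ''a'' 0 0 = a" "a \<le> \<delta> E s v" and q: "\<tau> ''q'' 0 0 = q"
  shows "sem n count_path \<tau> ''c'' 0 0 = card (missing W P a) \<and>
    sem n count_path \<tau> ''w'' 0 0 = (q + 1) * card (improved W s P a)"
proof -
  let ?c = "LIf (And (Less (Var ''i'') (Var ''a''))
         (Eq (Cell ''W'' (Arr ''P'' (Var ''i'')) (Arr ''P'' (Plus (Var ''i'') (Num 1)))) (Num 0)))
       (LSet ''c'' (Plus (Var ''c'') (Num 1)) ;;
        LIf (Less (Plus (Plus (Arr ''G'' (Arr ''P'' (Var ''i''))) (Arr ''D'' (Arr ''P'' (Var ''a'')))) (Num 2))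
                  (Plus (Arr ''D'' (Arr ''P'' (Var ''i''))) (Arr ''G'' (Arr ''P'' (Var ''a'')))))
          (LSet ''w'' (Plus (Var ''w'') (Plus (Var ''q'') (Num 1)))))"
  let ?Q = "\<lambda>i. i < a \<and> \<not> W (P i) (P (Suc i))"
  let ?R = "\<lambda>i. ?Q i \<and> \<delta> E s (P i) + \<delta> W s (P a) + 2 < \<delta> W s (P i) + \<delta> E s (P a)"
  let ?I = "\<lambda>j \<rho> :: state. \<rho> ''c'' 0 0 = card {i. i < j \<and> ?Q i} \<and>
     \<rho> ''w'' 0 0 = (q + 1) * card {i. i < j \<and> ?R i}"
  have L: "\<delta> E s v < n" using L_lt[OF W s P(1)] .
  let ?\<tau> = "sem n (LSet ''w'' (Num 0)) (sem n (LSet ''c'' (Num 0)) \<tau>)"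
  have "?I n (sem n count_path \<tau>)"
    unfolding count_path_def sem.simps(2)[of _ "LSet _ _"]
  proof (rule sem_For_invariant[where I = ?I])
    show "?I 0 ?\<tau>" by simp
    show "?I n (upd \<rho> ''i'' 0 0 n)" if "?I n \<rho>" for \<rho> using that by simp
  next
    fix j \<rho>
    assume j: "j < n" and I: "?I j \<rho>" and fr': "\<And>y. y \<notin> insert ''i'' (writes ?c) \<Longrightarrow> \<rho> y = ?\<tau> y"
    have \<rho>: "\<rho> ''W'' = \<sigma> ''W''" "\<rho> ''G'' = \<sigma> ''G''" "\<rho> ''D'' = \<sigma> ''D''" "\<rho> ''P'' = \<sigma> ''P''"
      "\<rho> ''a'' 0 0 = a" "\<rho> ''q'' 0 0 = q"
      using fr' fr a q by auto
    show "?I (Suc j) (sem n ?c (upd \<rho> ''i'' 0 0 j))"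
    proof (cases "j < a")
      case True
      then have lts: "P j < n" "P (Suc j) < n" "P a < n" using shortest_path_lt[OF P(1) v(2)] a by auto
      then have "\<sigma> ''W'' (P j) (P (Suc j)) = 0 \<longleftrightarrow> \<not> W (P j) (P (Suc j))"
        using W_adj by (auto simp: adj_def)
      then show ?thesis unfolding card_less_Suc_filter using True I \<rho> lts G D P(2) by simp
    next
      case False
      then show ?thesis unfolding card_less_Suc_filter using I \<rho> by simp
    qed
  qed
  moreover have "{i. i < n \<and> ?Q i} = missing W P a" "{i. i < n \<and> ?R i} = improved W s P a"
    using a L by (auto simp: missing_def improved_def)
  ultimately show ?thesis by simp
qed

lemma search_correct:
  assumes far: "\<delta> E s v + k + k < \<delta> W s v"
  shows "chosen W s v P (sem n search \<sigma> ''A'' 0 0)"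
proof -
  let ?L = "\<delta> E s v"
  let ?t = "LIf (And (Eq (Var ''F'') (Num 0))
              (And (Not (Less (Plus (Plus (Arr ''G'' (Arr ''P'' (Var ''a''))) (Var ''k'')) (Var ''k''))
                              (Arr ''D'' (Arr ''P'' (Var ''a'')))))
                   (Not (Less (Var ''w'') (Var ''c'')))))
          (LSet ''F'' (Num 1) ;; LSet ''A'' (Var ''a''))"
  let ?c = "LIf (Not (Less (Arr ''G'' (Var ''v'')) (Var ''a''))) (count_path ;; ?t)"
  let ?none = "\<lambda>q. \<forall>q'<q. \<forall>b\<le>?L. \<not> affordable W s P q' b"
  let ?found = "\<lambda>\<tau> :: state. \<tau> ''F'' 0 0 \<noteq> 0 \<and> chosen W s v P (\<tau> ''A'' 0 0)"
  let ?I = "\<lambda>q \<tau> :: state. (\<tau> ''F'' 0 0 = 0 \<and> ?none q) \<or> ?found \<tau>"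
  let ?\<sigma> = "sem n (LSet ''F'' (Num 0)) \<sigma>"
  have L: "?L < n" using L_lt[OF W s P(1)] .
  have "?I n (sem n search \<sigma>)"
    unfolding search_def sem.simps(2)[of _ "LSet ''F'' (Num 0)"]
  proof (rule sem_For_invariant[where I = ?I])
    show "?I 0 ?\<sigma>" by simp
    show "?I n (upd \<tau> ''q'' 0 0 n)" if "?I n \<tau>" for \<tau> using that by simp
  next
    fix q \<tau>
    assume q: "q < n" and I: "?I q \<tau>"
      and fr\<^sub>0: "\<And>y. y \<notin> insert ''q'' (writes (LFor ''a'' ?c)) \<Longrightarrow> \<tau> y = ?\<sigma> y"
    have fr: "\<tau> y = \<sigma> y" if "y \<in> {''W'', ''G'', ''D'', ''P'', ''k'', ''v''}" for y
      using that fr\<^sub>0[of y] by (auto simp: writes_count_path)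
    let ?\<tau> = "upd \<tau> ''q'' 0 0 q"
    let ?J = "\<lambda>a \<rho> :: state. (\<rho> ''F'' 0 0 = 0 \<and> ?none q \<and>
        (\<forall>b<a. b \<le> ?L \<longrightarrow> \<not> affordable W s P q b)) \<or> ?found \<rho>"
    have "?J n (sem n (LFor ''a'' ?c) ?\<tau>)"
    proof (rule sem_For_invariant[where I = ?J])
      show "?J 0 ?\<tau>" using I by auto
      show "?J n (upd \<rho> ''a'' 0 0 n)" if "?J n \<rho>" for \<rho> using that by simp
    next
      fix a \<rho>
      assume a: "a < n" and J: "?J a \<rho>" and fr': "\<And>y. y \<notin> insert ''a'' (writes ?c) \<Longrightarrow> \<rho> y = ?\<tau> y"
      let ?\<rho> = "upd \<rho> ''a'' 0 0 a"
      have \<rho>: "?\<rho> y = \<sigma> y" if "y \<in> {''W'', ''G'', ''D'', ''P'', ''k'', ''v''}" for y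
        using that fr[of y] fr'[of y] by (auto simp: writes_count_path)
      have \<rho>q: "?\<rho> ''q'' 0 0 = q" using fr' by (simp add: writes_count_path)
      show "?J (Suc a) (sem n ?c ?\<rho>)"
      proof (cases "a \<le> ?L")
        case False
        then have "sem n ?c ?\<rho> = ?\<rho>" using \<rho>[of "''G''"] \<rho>[of "''v''"] G v by simp
        then show ?thesis using J False by (auto simp: less_Suc_eq)
      next
        case True
        define \<rho>' where "\<rho>' = sem n count_path ?\<rho>"
        have eq: "sem n ?c ?\<rho> = sem n ?t \<rho>'"
          using \<rho>[of "''G''"] \<rho>[of "''v''"] G v True by (simp add: \<rho>'_def)
        have cw: "\<rho>' ''c'' 0 0 = card (missing W P a)" "\<rho>' ''w'' 0 0 = (q + 1) * card (improved W s P a)"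
          using count_path_correct[of ?\<rho> a q] \<rho> \<rho>q True by (auto simp: \<rho>'_def)
        have fr'': "\<rho>' y = ?\<rho> y" if "y \<notin> {''c'', ''w'', ''i''}" for y
          unfolding \<rho>'_def by (rule sem_frame) (use that writes_count_path in auto)
        have "\<rho>' y = \<sigma> y" if "y \<in> {''G'', ''D'', ''P'', ''k''}" for y
          by (rule trans[OF fr'' \<rho>]) (use that in auto)
        moreover have "\<rho>' ''a'' 0 0 = a" "\<rho>' ''F'' = \<rho> ''F''" "\<rho>' ''A'' = \<rho> ''A''"
          by (simp_all add: fr'')
        ultimately have *: "\<rho>' ''G'' = \<sigma> ''G''" "\<rho>' ''D'' = \<sigma> ''D''" "\<rho>' ''P'' = \<sigma> ''P''"
          "\<rho>' ''k'' = \<sigma> ''k''" "\<rho>' ''a'' 0 0 = a" "\<rho>' ''F'' = \<rho> ''F''" "\<rho>' ''A'' = \<rho> ''A''"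
          by auto
        have Pa: "P a < n" using shortest_path_lt[OF P(1) v(2)] True by simp
        have "sem n ?t \<rho>' = (if \<rho> ''F'' 0 0 = 0 \<and> affordable W s P q a
            then upd (upd \<rho>' ''F'' 0 0 1) ''A'' 0 0 a else \<rho>')"
          using * cw G D P(2) k_val Pa by (simp add: affordable_def not_less)
        then show ?thesis unfolding eq using J True *
          by (auto simp: chosen_def less_Suc_eq)
      qed
    qed
    then show "?I (Suc q) (sem n (LFor ''a'' ?c) ?\<tau>)"
      using L by (auto simp: less_Suc_eq)
  qed
  \<comment> \<open>The loop over \<open>q\<close> ends with \<open>n - 1\<close>, which is large
    enough: a shortest path has fewer than \<open>n\<close> edges, and \<open>k\<close> is
    positive.\<close>
  moreover have "\<exists>q<n. \<exists>b\<le>?L. affordable W s P q b"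
  proof -
    have "missing W P ?L \<subseteq> {..<?L}" by (auto simp: missing_def)
    from card_mono[OF _ this] have m: "card (missing W P ?L) < n" using L by simp
    also have "n = (n - 1 + 1) ^ 1" using L by simp
    also have "\<dots> \<le> (n - 1 + 1) ^ k" using k_ge1 by (intro power_increasing) auto
    finally have "\<exists>b\<le>?L. affordable W s P (n - 1) b"
      using exists_affordable[OF W s P(1) far] by blast
    then show ?thesis using L by (intro exI[of _ "n - 1"]) auto
  qed
  ultimately show ?thesis by auto
qed

end

lemma purchase_correct:
  fixes \<sigma> :: state
  assumes W: "adj n (\<sigma> ''W'') = W" and P: "\<forall>i. \<sigma> ''P'' i 0 = P i" and A: "\<sigma> ''A'' 0 0 = a"
    and a: "a < n" and P_lt: "\<And>i. i \<le> a \<Longrightarrow> P i < n"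
  shows "adj n (sem n purchase \<sigma> ''W'') = buy W P a"
proof -
  let ?c = "LIf (Less (Var ''i'') (Var ''A''))
     (LAssign ''W'' (Arr ''P'' (Var ''i'')) (Arr ''P'' (Plus (Var ''i'') (Num 1))) (Num 1) ;;
      LAssign ''W'' (Arr ''P'' (Plus (Var ''i'') (Num 1))) (Arr ''P'' (Var ''i'')) (Num 1))"
  let ?I = "\<lambda>j \<tau> :: state. adj n (\<tau> ''W'') = buy W P (min j a)"
  have "?I n (sem n purchase \<sigma>)"
    unfolding purchase_def
  proof (rule sem_For_invariant[where I = ?I])
    show "?I 0 \<sigma>" using W by (auto simp: buy_def fun_eq_iff)
    show "?I n (upd \<tau> ''i'' 0 0 n)" if "?I n \<tau>" for \<tau> using that by simp
  next
    fix j \<tau>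
    assume j: "j < n" and I: "?I j \<tau>" and "\<And>y. y \<notin> insert ''i'' (writes ?c) \<Longrightarrow> \<tau> y = \<sigma> y"
    then have \<tau>: "\<tau> ''P'' = \<sigma> ''P''" "\<tau> ''A'' = \<sigma> ''A''" by auto
    show "?I (Suc j) (sem n ?c (upd \<tau> ''i'' 0 0 j))"
    proof (cases "j < a")
      case True
      have upds: "sem n ?c (upd \<tau> ''i'' 0 0 j) =
          upd (upd (upd \<tau> ''i'' 0 0 j) ''W'' (P j) (P (Suc j)) 1) ''W'' (P (Suc j)) (P j) 1"
        using True \<tau> P A by simp
      have "sem n ?c (upd \<tau> ''i'' 0 0 j) ''W'' x y =
          (if (x = P j \<and> y = P (Suc j)) \<or> (x = P (Suc j) \<and> y = P j) then 1 else \<tau> ''W'' x y)" for x y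
        unfolding upds by (simp add: upd_upd_swap)
      then have "adj n (sem n ?c (upd \<tau> ''i'' 0 0 j) ''W'') x y \<longleftrightarrow>
          adj n (\<tau> ''W'') x y \<or> (x = P j \<and> y = P (Suc j)) \<or> (x = P (Suc j) \<and> y = P j)" for x y
        using True P_lt[of j] P_lt[of "Suc j"] by (auto simp: adj_def)
      then show ?thesis unfolding I using True by (auto simp: buy_def fun_eq_iff less_Suc_eq)
    next
      case False
      then show ?thesis using I \<tau> A by (simp add: min_def)
    qed
  qed
  then show ?thesis using a by simp
qed

text \<open>The relation to be chained over all purchases. The inequality is stated for all
  admissible \<open>q\<close>, since no particular \<open>q\<close> is fixed before the final
  estimate; for \<open>S = {}\<close> nothing is bought, which keeps the initial edge count
  available.\<close>

definition grows where
  "grows d W W' \<longleftrightarrow> subgraph W' \<and> (\<forall>x y. W x y \<longrightarrow> W' x y) \<and> (S = {} \<longrightarrow> W' = W) \<and>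
     (\<forall>q. 3 * n < d * (q + 1) ^ k \<longrightarrow>
        d * card (cells W') + 6 * (q + 1) * pot W' \<le> d * card (cells W) + 6 * (q + 1) * pot W)"

lemma process_pair_correct:
  fixes \<sigma> :: state
  assumes E: "adj n (\<sigma> ''E'') = E" and Sv: "\<forall>i<n. 0 < \<sigma> ''S'' i 0 \<longleftrightarrow> i \<in> S"
    and k_val: "\<sigma> ''k'' 0 0 = k" and M_val: "\<sigma> ''M'' 0 0 = M"
    and s: "\<sigma> ''s'' 0 0 = s" "s < n" and v: "\<sigma> ''v'' 0 0 = v" "v < n"
    and W: "subgraph W" "dense d W" "adj n (\<sigma> ''W'') = W"
  defines "W' \<equiv> adj n (sem n process_pair \<sigma> ''W'')"
  shows "grows d W W' \<and> (s \<in> S \<longrightarrow> \<delta> W' s v \<le> \<delta> E s v + k + k)"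
proof -
  let ?\<sigma>1 = "sem n (bellman_ford ''E'' ''G'') \<sigma>"
  let ?\<sigma>2 = "sem n (bellman_ford ''W'' ''D'') ?\<sigma>1"
  have Eg: "nat_graph n E" by unfold_locales
  have Wg: "nat_graph n W" using W by (simp add: subgraph_def)
  have fr1: "?\<sigma>1 y = \<sigma> y" if "y \<notin> {''u'', ''x'', ''r'', ''G''}" for y
    by (rule sem_frame) (use that writes_bellman_ford in auto)
  have fr2: "?\<sigma>2 y = ?\<sigma>1 y" if "y \<notin> {''u'', ''x'', ''r'', ''D''}" for y
    by (rule sem_frame) (use that writes_bellman_ford in auto)
  have G1: "?\<sigma>1 ''G'' x 0 = \<delta> E s x" if "x < n" for x
    using bellman_ford_correct[of "''E''" "''G''" n \<sigma> s M x] E Eg s M_val that by simp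
  have D: "?\<sigma>2 ''D'' x 0 = \<delta> W s x" if "x < n" for x
    using bellman_ford_correct[of "''W''" "''D''" n ?\<sigma>1 s M x] fr1 W Wg s M_val that by simp
  have G: "?\<sigma>2 ''G'' x 0 = \<delta> E s x" if "x < n" for x using fr2[of "''G''"] G1 that by simp
  have fr: "?\<sigma>2 y = \<sigma> y" if "y \<notin> {''u'', ''x'', ''r'', ''G'', ''D''}" for y
    using fr1 fr2 that by auto
  have vals: "?\<sigma>2 ''S'' = \<sigma> ''S''" "?\<sigma>2 ''s'' 0 0 = s" "?\<sigma>2 ''v'' 0 0 = v" "?\<sigma>2 ''k'' 0 0 = k"
    "?\<sigma>2 ''W'' = \<sigma> ''W''" "?\<sigma>2 ''E'' = \<sigma> ''E''"
    using fr s v k_val by auto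
  have eq: "sem n process_pair \<sigma> = (if s \<in> S \<and> \<delta> E s v + k + k < \<delta> W s v
      then sem n purchase (sem n search (sem n backtrack ?\<sigma>2)) else ?\<sigma>2)"
    using vals G D Sv s v by (simp add: process_pair_def)
  show ?thesis
  proof (cases "s \<in> S \<and> \<delta> E s v + k + k < \<delta> W s v")
    case False
    then have "W' = W" unfolding W'_def eq using vals W by (simp only: if_False)
    then show ?thesis using False W(1) by (auto simp: grows_def)
  next
    case True
    \<comment> \<open>An unreachable \<open>v\<close> has distance \<open>M\<close> in
      \<open>E\<close>, and no distance in \<open>W\<close> exceeds \<open>M\<close>, so such a pair
      never passes the test.\<close>
    have "\<exists>l. (E ^^ l) s v"
    proof (rule ccontr)
      assume "\<nexists>l. (E ^^ l) s v"
      then have "\<delta> E s v = M" by (simp add: dist_cap_unreachable)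
      moreover have "\<delta> W s v \<le> M"
        by (cases rule: nat_graph.dist_cap_cases[OF Wg s(2), of M v]) auto
      ultimately show False using True by linarith
    qed
    let ?\<sigma>3 = "sem n backtrack ?\<sigma>2"
    define P where "P = (\<lambda>i. ?\<sigma>3 ''P'' i 0)"
    have P: "shortest_path s v P"
      unfolding P_def by (rule backtrack_correct) (use E v s vals G \<open>\<exists>l. _\<close> in auto)
    have fr3: "?\<sigma>3 y = ?\<sigma>2 y" if "y \<notin> {''P'', ''i'', ''x''}" for y
      by (rule sem_frame) (use that writes_backtrack in auto)
    define a where "a = sem n search ?\<sigma>3 ''A'' 0 0"
    have "chosen W s v P a"
      unfolding a_def
      by (rule search_correct) (use W(1,3) True P fr3 vals v(2) G D P_def in simp_all)
    then obtain q\<^sub>0 where a: "a \<le> \<delta> E s v" and aff: "affordable W s P q\<^sub>0 a"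
      and least: "\<And>q b. q < q\<^sub>0 \<Longrightarrow> b \<le> \<delta> E s v \<Longrightarrow> \<not> affordable W s P q b"
      by (auto simp: chosen_def)
    have fr4: "sem n search ?\<sigma>3 y = ?\<sigma>3 y" if "y \<in> {''P'', ''W''}" for y
      by (rule sem_frame) (use that writes_search in auto)
    have sS: "s \<in> S" using True by simp
    have "a < n" using a L_lt[OF W(1) sS P] by linarith
    moreover have "P i < n" if "i \<le> a" for i
      using shortest_path_lt[OF P v(2)] that a by simp
    ultimately have W': "W' = buy W P a"
      unfolding W'_def eq using True purchase_correct[of "sem n search ?\<sigma>3" W P a] fr3 fr4 vals W
      by (simp add: a_def P_def)
    have "grows d W W'"
      unfolding grows_def W'
      using subgraph_buy[OF W(1) sS P a aff] sS
        buy_amortized[OF W(1) sS P W(2) _ a aff least] True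
      by (auto simp: buy_def)
    moreover have "\<delta> W' s v \<le> \<delta> E s v + k + k"
      unfolding W' by (rule buy_near[OF W(1) sS P a aff])
    ultimately show ?thesis by simp
  qed
qed

end


section \<open>The algorithm\<close>

definition fill :: "vname \<Rightarrow> aexp \<Rightarrow> lcom" where
  "fill X e = LFor ''u'' (LFor ''x'' (LAssign X (Var ''u'') (Var ''x'') e))"

text \<open>The counter \<open>c\<close> also counts edges that an earlier node has already put into
  \<open>W\<close>: a node selects at most \<open>d\<close> edges but may end up with more.\<close>

definition greedy :: lcom where
  "greedy = fill ''W'' (Num 0) ;;
     LFor ''u'' (LSet ''c'' (Num 0) ;;
       LFor ''x'' (LIf (And (Less (Num 0) (Cell ''E'' (Var ''u'') (Var ''x''))) (Less (Var ''c'') (Var ''d'')))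
         (LAssign ''W'' (Var ''u'') (Var ''x'') (Num 1) ;;
          LAssign ''W'' (Var ''x'') (Var ''u'') (Num 1) ;;
          LSet ''c'' (Plus (Var ''c'') (Num 1)))))"

definition count_zeros :: lcom where
  "count_zeros = LSet ''Z'' (Num 0) ;;
     LFor ''u'' (LFor ''x'' (LIf (Eq (Cell ''W'' (Var ''u'') (Var ''x'')) (Num 0))
       (LSet ''Z'' (Plus (Var ''Z'') (Num 1)))))"

definition build :: lcom where
  "build = greedy ;; LFor ''s'' (LFor ''v'' process_pair)"

text \<open>Maximising the number of zeros of the matrix, rather than minimising the number of edges, makes
  the initial value \<open>0\<close> of \<open>B\<close> neutral.\<close>

definition keep_best :: lcom where
  "keep_best = count_zeros ;; LIf (Not (Less (Var ''Z'') (Var ''B'')))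
     (LSet ''B'' (Var ''Z'') ;; fill ''H'' (Cell ''W'' (Var ''u'') (Var ''x'')))"

definition spanner_prog :: lcom where
  "spanner_prog = LSet ''M'' (Plus (Plus (Plus (Var ''n'') (Var ''k'')) (Var ''k'')) (Num 2)) ;;
     LFor ''d'' (build ;; keep_best)"

lemma writes_fill: "writes (fill X e) = {''u'', ''x'', X}"
  by (auto simp: fill_def)

lemma writes_greedy: "writes greedy = {''u'', ''x'', ''c'', ''W''}"
  by (auto simp: greedy_def writes_fill)

lemma writes_count_zeros: "writes count_zeros = {''u'', ''x'', ''Z''}"
  by (auto simp: count_zeros_def)

lemma writes_build: "writes build = {''s'', ''v'', ''u'', ''x'', ''r'', ''G'', ''D'', ''P'', ''i'', ''F'',
    ''q'', ''a'', ''c'', ''w'', ''A'', ''W''}"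
  by (auto simp: build_def writes_greedy writes_process_pair)

lemma writes_keep_best: "writes keep_best = {''u'', ''x'', ''Z'', ''B'', ''H''}"
  by (auto simp: keep_best_def writes_count_zeros writes_fill)

lemma writes_spanner_prog: "''n'' \<notin> writes spanner_prog"
  by (auto simp: spanner_prog_def writes_build writes_keep_best)

lemma wf_spanner_prog: "wf_loops spanner_prog"
proof -
  have "wf_loops process_pair"
    by (simp add: process_pair_def bellman_ford_def relax_def backtrack_def search_def count_path_def
        purchase_def)
  then have "wf_loops build"
    by (simp add: build_def greedy_def fill_def writes_process_pair)
  moreover have "wf_loops keep_best"
    by (simp add: keep_best_def count_zeros_def fill_def)
  ultimately show ?thesis
    by (simp add: spanner_prog_def writes_build writes_keep_best)
qed

section \<open>Correctness of the matrix routines\<close>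

lemma fill_correct:
  fixes \<sigma> :: state
  assumes X: "X \<notin> {''u'', ''x''}"
    and e: "\<And>\<tau> i j. i < n \<Longrightarrow> j < n \<Longrightarrow> (\<And>y. y \<notin> {''u'', ''x'', X} \<Longrightarrow> \<tau> y = \<sigma> y) \<Longrightarrow>
      \<tau> ''u'' 0 0 = i \<Longrightarrow> \<tau> ''x'' 0 0 = j \<Longrightarrow> aval e \<tau> = f i j"
  shows "\<forall>i<n. \<forall>j<n. sem n (fill X e) \<sigma> X i j = f i j"
proof -
  let ?c = "LAssign X (Var ''u'') (Var ''x'') e"
  let ?I = "\<lambda>m \<tau> :: state. \<forall>i<m. \<forall>j<n. \<tau> X i j = f i j"
  show "?I n (sem n (fill X e) \<sigma>)"
    unfolding fill_def
  proof (rule sem_For_invariant[where I = ?I])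
    show "?I n (upd \<tau> ''u'' 0 0 n)" if "?I n \<tau>" for \<tau> using that X by simp
  next
    fix i \<tau>
    assume i: "i < n" and I: "?I i \<tau>" and fr: "\<And>y. y \<notin> insert ''u'' (writes (LFor ''x'' ?c)) \<Longrightarrow> \<tau> y = \<sigma> y"
    let ?\<tau> = "upd \<tau> ''u'' 0 0 i"
    let ?J = "\<lambda>m \<rho> :: state. ?I i \<rho> \<and> (\<forall>j<m. \<rho> X i j = f i j)"
    have "?J n (sem n (LFor ''x'' ?c) ?\<tau>)"
    proof (rule sem_For_invariant[where I = ?J])
      show "?J 0 ?\<tau>" using I X by simp
      show "?J n (upd \<rho> ''x'' 0 0 n)" if "?J n \<rho>" for \<rho> using that X by simp
    next
      fix j \<rho>
      assume j: "j < n" and J: "?J j \<rho>" and fr': "\<And>y. y \<notin> insert ''x'' (writes ?c) \<Longrightarrow> \<rho> y = ?\<tau> y"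
      let ?\<rho> = "upd \<rho> ''x'' 0 0 j"
      have u: "?\<rho> ''u'' 0 0 = i" using fr'[of "''u''"] X by auto
      have "aval e ?\<rho> = f i j"
      proof (rule e[of i j ?\<rho>, OF i j _ u])
        show "?\<rho> y = \<sigma> y" if "y \<notin> {''u'', ''x'', X}" for y
          using that fr[of y] fr'[of y] by simp
      qed simp
      with u have "sem n ?c ?\<rho> = upd ?\<rho> X i j (f i j)" by simp
      then show "?J (Suc j) (sem n ?c ?\<rho>)" using J X by (auto simp: upd_apply less_Suc_eq)
    qed
    then show "?I (Suc i) (sem n (LFor ''x'' ?c) ?\<tau>)" by (auto simp: less_Suc_eq)
  qed simp
qed

lemma count_zeros_correct:
  fixes \<sigma> :: state
  shows "sem n count_zeros \<sigma> ''Z'' 0 0 = (\<Sum>i<n. \<Sum>j<n. if \<sigma> ''W'' i j = 0 then 1 else 0)"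
proof -
  let ?c = "LIf (Eq (Cell ''W'' (Var ''u'') (Var ''x'')) (Num 0)) (LSet ''Z'' (Plus (Var ''Z'') (Num 1)))"
  let ?z = "\<lambda>i j. if \<sigma> ''W'' i j = 0 then 1 else 0 :: nat"
  let ?I = "\<lambda>m \<tau> :: state. \<tau> ''Z'' 0 0 = (\<Sum>i<m. \<Sum>j<n. ?z i j)"
  let ?\<sigma> = "sem n (LSet ''Z'' (Num 0)) \<sigma>"
  show "?I n (sem n count_zeros \<sigma>)"
    unfolding count_zeros_def sem.simps(2)
  proof (rule sem_For_invariant[where I = ?I])
    show "?I 0 ?\<sigma>" by simp
    show "?I n (upd \<tau> ''u'' 0 0 n)" if "?I n \<tau>" for \<tau> using that by simp
  next
    fix i \<tau>
    assume i: "i < n" and I: "?I i \<tau>" and fr: "\<And>y. y \<notin> insert ''u'' (writes (LFor ''x'' ?c)) \<Longrightarrow> \<tau> y = ?\<sigma> y"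
    let ?\<tau> = "upd \<tau> ''u'' 0 0 i"
    let ?J = "\<lambda>m \<rho> :: state. \<rho> ''Z'' 0 0 = (\<Sum>l<i. \<Sum>j<n. ?z l j) + (\<Sum>j<m. ?z i j)"
    have "?J n (sem n (LFor ''x'' ?c) ?\<tau>)"
    proof (rule sem_For_invariant[where I = ?J])
      show "?J 0 ?\<tau>" using I by simp
      show "?J n (upd \<rho> ''x'' 0 0 n)" if "?J n \<rho>" for \<rho> using that by simp
    next
      fix j \<rho>
      assume j: "j < n" and J: "?J j \<rho>" and fr': "\<And>y. y \<notin> insert ''x'' (writes ?c) \<Longrightarrow> \<rho> y = ?\<tau> y"
      have "\<rho> ''W'' = \<sigma> ''W''" "\<rho> ''u'' 0 0 = i"
        using fr[of "''W''"] fr'[of "''W''"] fr'[of "''u''"] by auto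
      then show "?J (Suc j) (sem n ?c (upd \<rho> ''x'' 0 0 j))" using J by simp
    qed
    then show "?I (Suc i) (sem n (LFor ''x'' ?c) ?\<tau>)" by simp
  qed
qed

context spanner_input
begin

lemma card_cells_adj:
  "card (cells (adj n X)) + (\<Sum>i<n. \<Sum>j<n. if X i j = 0 then 1 else 0) = n * n"
proof -
  have "cells (adj n X) = {p \<in> {..<n} \<times> {..<n}. 0 < X (fst p) (snd p)}"
    by (auto simp: cells_def adj_def)
  then have "card (cells (adj n X)) = (\<Sum>p\<in>{..<n} \<times> {..<n}. if 0 < X (fst p) (snd p) then 1 else 0)"
    by (simp add: sum.If_cases Int_def)
  also have "\<dots> = (\<Sum>i<n. \<Sum>j<n. if 0 < X i j then 1 else 0)"
    by (simp add: sum.cartesian_product split_beta)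
  finally have "card (cells (adj n X)) + (\<Sum>i<n. \<Sum>j<n. if X i j = 0 then 1 else 0)
      = (\<Sum>i<n. \<Sum>j<n. (if 0 < X i j then 1 else 0) + (if X i j = 0 then 1 else 0))"
    by (simp add: sum.distrib)
  also have "\<dots> = (\<Sum>i<n. \<Sum>j<n. 1)" by (intro sum.cong refl) auto
  finally show ?thesis by simp
qed

text \<open>A node whose counter stays below \<open>d\<close> has got all its edges, any other one
  at least \<open>d\<close> neighbours; both properties survive later insertions. Each of the at
  most \<open>d\<close> selections per node adds at most two cells.\<close>

lemma greedy_correct:
  fixes \<sigma> :: state
  assumes E: "adj n (\<sigma> ''E'') = E" and d: "\<sigma> ''d'' 0 0 = d"
  defines "W \<equiv> adj n (sem n greedy \<sigma> ''W'')"
  shows "subgraph W \<and> dense d W \<and> card (cells W) \<le> 2 * d * n"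
proof -
  let ?c = "LIf (And (Less (Num 0) (Cell ''E'' (Var ''u'') (Var ''x''))) (Less (Var ''c'') (Var ''d'')))
         (LAssign ''W'' (Var ''u'') (Var ''x'') (Num 1) ;;
          LAssign ''W'' (Var ''x'') (Var ''u'') (Num 1) ;;
          LSet ''c'' (Plus (Var ''c'') (Num 1)))"
  let ?r = "LSet ''c'' (Num 0) ;; LFor ''x'' ?c"
  let ?W = "\<lambda>\<tau> :: state. adj n (\<tau> ''W'')"
  let ?full = "\<lambda>W u. (\<forall>v. E u v \<longrightarrow> W u v) \<or> d \<le> card {z. W u z}"
  let ?I = "\<lambda>m \<tau> :: state. subgraph (?W \<tau>) \<and> (\<forall>u<m. ?full (?W \<tau>) u) \<and>
    card (cells (?W \<tau>)) \<le> 2 * d * m"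
  let ?\<sigma> = "sem n (fill ''W'' (Num 0)) \<sigma>"
  have "?I n (sem n greedy \<sigma>)"
    unfolding greedy_def sem.simps(2)[of _ "fill ''W'' (Num 0)"]
  proof (rule sem_For_invariant[where I = ?I])
    have "\<forall>i<n. \<forall>j<n. ?\<sigma> ''W'' i j = 0"
      using fill_correct[of "''W''" n \<sigma> "Num 0" "\<lambda>_ _. 0"] by simp
    then have "?W ?\<sigma> = (\<lambda>_ _. False)" by (auto simp: adj_def fun_eq_iff)
    then show "?I 0 ?\<sigma>" by (simp add: subgraph_def nat_graph_def cells_def)
    show "?I n (upd \<tau> ''u'' 0 0 n)" if "?I n \<tau>" for \<tau> using that by simp
  next
    fix i \<tau>
    assume i: "i < n" and I: "?I i \<tau>" and fr: "\<And>y. y \<notin> insert ''u'' (writes ?r) \<Longrightarrow> \<tau> y = ?\<sigma> y"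
    have \<tau>E: "\<tau> ''E'' = \<sigma> ''E''" "\<tau> ''d'' = \<sigma> ''d''"
      using fr[of "''E''"] fr[of "''d''"] by (auto simp: sem_frame writes_fill)
    let ?\<tau> = "sem n (LSet ''c'' (Num 0)) (upd \<tau> ''u'' 0 0 i)"
    let ?J = "\<lambda>m \<rho> :: state. subgraph (?W \<rho>) \<and> (\<forall>x y. ?W \<tau> x y \<longrightarrow> ?W \<rho> x y) \<and> \<rho> ''c'' 0 0 \<le> d \<and>
      card (cells (?W \<rho>)) \<le> 2 * d * i + 2 * \<rho> ''c'' 0 0 \<and>
      \<rho> ''c'' 0 0 \<le> card {z. z < m \<and> ?W \<rho> i z} \<and>
      (\<rho> ''c'' 0 0 < d \<longrightarrow> (\<forall>v<m. E i v \<longrightarrow> ?W \<rho> i v))"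
    have J: "?J n (sem n (LFor ''x'' ?c) ?\<tau>)"
    proof (rule sem_For_invariant[where I = ?J])
      show "?J 0 ?\<tau>" using I by simp
      show "?J n (upd \<rho> ''x'' 0 0 n)" if "?J n \<rho>" for \<rho> using that by simp
    next
      fix j \<rho>
      assume j: "j < n" and J: "?J j \<rho>" and fr': "\<And>y. y \<notin> insert ''x'' (writes ?c) \<Longrightarrow> \<rho> y = ?\<tau> y"
      have \<rho>: "\<rho> ''E'' = \<sigma> ''E''" "\<rho> ''d'' 0 0 = d" "\<rho> ''u'' 0 0 = i"
        using fr'[of "''E''"] fr'[of "''d''"] fr'[of "''u''"] \<tau>E d by auto
      have Eij: "0 < \<sigma> ''E'' i j \<longleftrightarrow> E i j" using E i j by (auto simp: adj_def)
      let ?c' = "\<rho> ''c'' 0 0"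
      show "?J (Suc j) (sem n ?c (upd \<rho> ''x'' 0 0 j))"
      proof (cases "E i j \<and> ?c' < d")
        case False
        then have eq: "sem n ?c (upd \<rho> ''x'' 0 0 j) = upd \<rho> ''x'' 0 0 j"
          using \<rho> Eij by auto
        have "card {z. z < j \<and> ?W \<rho> i z} \<le> card {z. z < Suc j \<and> ?W \<rho> i z}"
          by (rule card_mono) auto
        then show ?thesis unfolding eq using J False by (auto simp: less_Suc_eq)
      next
        case True
        define \<rho>' where "\<rho>' = sem n ?c (upd \<rho> ''x'' 0 0 j)"
        have "\<rho>' = upd (upd (upd (upd \<rho> ''x'' 0 0 j) ''W'' i j 1) ''W'' j i 1) ''c'' 0 0 (?c' + 1)"
          unfolding \<rho>'_def using \<rho> Eij True by simp
        then have c: "\<rho>' ''c'' 0 0 = ?c' + 1"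
          and "\<rho>' ''W'' x y = (if (x = i \<and> y = j) \<or> (x = j \<and> y = i) then 1 else \<rho> ''W'' x y)" for x y
          by (simp_all add: upd_upd_swap)
        then have W: "?W \<rho>' x y \<longleftrightarrow> ?W \<rho> x y \<or> (x = i \<and> y = j) \<or> (x = j \<and> y = i)" for x y
          using i j by (auto simp: adj_def)
        have sub: "subgraph (?W \<rho>')"
          using J True sym i j unfolding subgraph_def nat_graph_def W by blast
        have "cells (?W \<rho>') \<subseteq> cells (?W \<rho>) \<union> {(i, j), (j, i)}"
          by (auto simp: cells_def W)
        then have "card (cells (?W \<rho>')) \<le> card (cells (?W \<rho>) \<union> {(i, j), (j, i)})"
          using J by (intro card_mono) (auto simp: finite_cells)
        also have "\<dots> \<le> card (cells (?W \<rho>)) + card {(i, j), (j, i)}" by (rule card_Un_le)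
        also have "card {(i, j), (j, i)} \<le> 2" using card_length[of "[(i, j), (j, i)]"] by auto
        finally have cells: "card (cells (?W \<rho>')) \<le> 2 * d * i + 2 * (?c' + 1)" using J by simp
        \<comment> \<open>The column \<open>j\<close> enters the range only now, so the count grows
          even if the edge was already there.\<close>
        have "card {z. z < j \<and> ?W \<rho> i z} + 1 = card (insert j {z. z < j \<and> ?W \<rho> i z})" by simp
        also have "\<dots> \<le> card {z. z < Suc j \<and> ?W \<rho>' i z}"
          by (rule card_mono) (auto simp: W)
        finally have "?c' + 1 \<le> card {z. z < Suc j \<and> ?W \<rho>' i z}" using J by simp
        moreover have "\<forall>v<Suc j. E i v \<longrightarrow> ?W \<rho>' i v" using J True by (auto simp: W less_Suc_eq)
        moreover have "\<forall>x y. ?W \<tau> x y \<longrightarrow> ?W \<rho>' x y" using J by (auto simp: W)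
        ultimately show ?thesis unfolding \<rho>'_def[symmetric] c using sub cells True by simp
      qed
    qed
    let ?\<rho> = "sem n (LFor ''x'' ?c) ?\<tau>"
    have sub: "subgraph (?W ?\<rho>)" using J by blast
    have "?full (?W ?\<rho>) i"
    proof (cases "?\<rho> ''c'' 0 0 < d")
      case True
      then show ?thesis using J sym lt by blast
    next
      case False
      then have "d \<le> card {z. z < n \<and> ?W ?\<rho> i z}" using J by linarith
      also have "{z. z < n \<and> ?W ?\<rho> i z} = {z. ?W ?\<rho> i z}" by (auto simp: adj_def)
      finally show ?thesis by simp
    qed
    moreover have "?full (?W ?\<rho>) u" if "u < i" for u
    proof -
      have "card {z. ?W \<tau> u z} \<le> card {z. ?W ?\<rho> u z}"
        using J by (intro card_mono finite_neighbours[OF sub]) blast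
      moreover have "?full (?W \<tau>) u" using I that by blast
      ultimately show ?thesis using J by (meson le_trans)
    qed
    moreover have "card (cells (?W ?\<rho>)) \<le> 2 * d * Suc i"
    proof -
      have "card (cells (?W ?\<rho>)) \<le> 2 * d * i + 2 * ?\<rho> ''c'' 0 0" "?\<rho> ''c'' 0 0 \<le> d" using J by blast+
      then show ?thesis by simp
    qed
    ultimately show "?I (Suc i) (sem n ?r (upd \<tau> ''u'' 0 0 i))"
      unfolding sem.simps(2) using sub by (auto simp: less_Suc_eq)
  qed
  then show ?thesis unfolding W_def dense_def using lt by blast
qed

section \<open>Accumulation over all pairs and the choice of the best \<open>d\<close>\<close>

lemma grows_trans: "grows d A B \<Longrightarrow> grows d B C \<Longrightarrow> grows d A C"
  unfolding grows_def by (meson le_trans)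

lemma grows_refl: "subgraph W \<Longrightarrow> grows d W W"
  by (simp add: grows_def)

lemma dense_grows: "dense d W \<Longrightarrow> grows d W W' \<Longrightarrow> dense d W'"
proof -
  assume W: "dense d W" and W': "grows d W W'"
  have "card {z. W x z} \<le> card {z. W' x z}" for x
    using W' by (intro card_mono finite_neighbours) (auto simp: grows_def)
  then show ?thesis using W W' unfolding dense_def grows_def by (meson le_trans)
qed

lemma grows_dist: "subgraph W \<Longrightarrow> grows d W W' \<Longrightarrow> s < n \<Longrightarrow> \<delta> W' s v \<le> \<delta> W s v"
  by (rule dist_cap_antimono) (auto simp: grows_def subgraph_def)

definition is_spanner where
  "is_spanner W \<longleftrightarrow> subgraph W \<and> (\<forall>s\<in>S. \<forall>v<n. \<delta> W s v \<le> \<delta> E s v + k + k)"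

text \<open>The first conjunct is needed for \<open>S = {}\<close>, where the empty spanner is demanded; it is built
  for \<open>d = 0\<close>.\<close>

definition is_small where
  "is_small d W \<longleftrightarrow> (S = {} \<longrightarrow> card (cells W) \<le> 2 * d * n) \<and>
     (\<forall>q. 3 * n < d * (q + 1) ^ k \<longrightarrow>
       d * card (cells W) \<le> d * (2 * d * n) + 6 * (q + 1) * (card S * (n * (2 * k + 3))))"

definition represented :: "state \<Rightarrow> bool" where
  "represented \<sigma> \<longleftrightarrow> adj n (\<sigma> ''E'') = E \<and> (\<forall>i<n. 0 < \<sigma> ''S'' i 0 \<longleftrightarrow> i \<in> S) \<and>
     \<sigma> ''k'' 0 0 = k \<and> \<sigma> ''M'' 0 0 = M"

lemma represented_cong:
  "represented \<sigma> \<Longrightarrow> (\<And>y. y \<in> {''E'', ''S'', ''k'', ''M''} \<Longrightarrow> \<tau> y = \<sigma> y) \<Longrightarrow> represented \<tau>"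
  by (simp add: represented_def)

lemma pot_le: "pot W \<le> card S * (n * (2 * k + 3))"
proof -
  have "pot W \<le> (\<Sum>s\<in>S. \<Sum>z<n. 2 * k + 3)"
    unfolding pot_def by (intro sum_mono) simp
  then show ?thesis by simp
qed

text \<open>The inequality in \<open>grows\<close> telescopes over all pairs: it starts with the
  greedy graph and its potential, and what remains of the potential is dropped at the end. Pairs
  treated earlier stay good because distances only decrease.\<close>

lemma build_correct:
  fixes \<sigma> :: state
  assumes rep: "represented \<sigma>" and d: "\<sigma> ''d'' 0 0 = d"
  defines "W' \<equiv> adj n (sem n build \<sigma> ''W'')"
  shows "is_spanner W' \<and> is_small d W'"
proof -
  let ?\<sigma> = "sem n greedy \<sigma>"
  let ?W = "\<lambda>\<tau> :: state. adj n (\<tau> ''W'')"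
  have W0: "subgraph (?W ?\<sigma>)" "dense d (?W ?\<sigma>)" "card (cells (?W ?\<sigma>)) \<le> 2 * d * n"
    using greedy_correct[of \<sigma> d] d rep by (auto simp: represented_def)
  let ?near = "\<lambda>\<tau> s v. s \<in> S \<longrightarrow> \<delta> (?W \<tau>) s v \<le> \<delta> E s v + k + k"
  let ?I = "\<lambda>m \<tau> :: state. grows d (?W ?\<sigma>) (?W \<tau>) \<and> (\<forall>s<m. \<forall>v<n. ?near \<tau> s v)"
  have I: "?I n (sem n build \<sigma>)"
    unfolding build_def sem.simps(2)
  proof (rule sem_For_invariant[where I = ?I])
    show "?I 0 ?\<sigma>" using W0 by (simp add: grows_refl)
    show "?I n (upd \<tau> ''s'' 0 0 n)" if "?I n \<tau>" for \<tau> using that by simp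
  next
    fix s \<tau>
    assume s: "s < n" and I: "?I s \<tau>"
      and fr: "\<And>y. y \<notin> insert ''s'' (writes (LFor ''v'' process_pair)) \<Longrightarrow> \<tau> y = ?\<sigma> y"
    let ?\<tau> = "upd \<tau> ''s'' 0 0 s"
    let ?J = "\<lambda>m \<rho> :: state. grows d (?W ?\<sigma>) (?W \<rho>) \<and> (\<forall>t<s. \<forall>v<n. ?near \<rho> t v) \<and>
      (\<forall>v<m. ?near \<rho> s v)"
    have "?J n (sem n (LFor ''v'' process_pair) ?\<tau>)"
    proof (rule sem_For_invariant[where I = ?J])
      show "?J 0 ?\<tau>" using I by simp
      show "?J n (upd \<rho> ''v'' 0 0 n)" if "?J n \<rho>" for \<rho> using that by simp
    next
      fix v \<rho>
      assume v: "v < n" and J: "?J v \<rho>"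
        and fr': "\<And>y. y \<notin> insert ''v'' (writes process_pair) \<Longrightarrow> \<rho> y = ?\<tau> y"
      let ?\<rho> = "upd \<rho> ''v'' 0 0 v"
      have "?\<rho> y = \<sigma> y" if "y \<in> {''E'', ''S'', ''k'', ''M''}" for y
      proof -
        have "?\<rho> y = \<rho> y" using that by auto
        also have "\<rho> y = ?\<tau> y" using that by (intro fr') (auto simp: writes_process_pair)
        also have "?\<tau> y = \<tau> y" using that by auto
        also have "\<tau> y = ?\<sigma> y" using that by (intro fr) (auto simp: writes_process_pair)
        also have "?\<sigma> y = \<sigma> y" using that by (intro sem_frame) (auto simp: writes_greedy)
        finally show ?thesis .
      qed
      then have rep': "represented ?\<rho>" by (rule represented_cong[OF rep])
      have s': "?\<rho> ''s'' 0 0 = s" using fr'[of "''s''"] by (simp add: writes_process_pair)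
      have W: "?W ?\<rho> = ?W \<rho>" by simp
      have sub: "subgraph (?W \<rho>)" using J by (simp add: grows_def)
      have P: "grows d (?W \<rho>) (?W (sem n process_pair ?\<rho>))" "?near (sem n process_pair ?\<rho>) s v"
        using process_pair_correct[of ?\<rho> s v "?W \<rho>" d] rep' s s' v W sub
          dense_grows[OF W0(2), of "?W \<rho>"] J
        by (auto simp: represented_def)
      have "?near (sem n process_pair ?\<rho>) s'' v''" if "?near \<rho> s'' v''" "s'' < n" for s'' v''
        using that grows_dist[OF sub P(1)] by (meson le_trans)
      then show "?J (Suc v) (sem n process_pair ?\<rho>)"
        using J P s grows_trans[OF _ P(1)] by (simp add: less_Suc_eq)
    qed
    then show "?I (Suc s) (sem n (LFor ''v'' process_pair) ?\<tau>)" by (auto simp: less_Suc_eq)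
  qed
  then have g: "grows d (?W ?\<sigma>) W'" by (simp add: W'_def)
  have "is_spanner W'"
    using I S_lt unfolding W'_def is_spanner_def grows_def by blast
  moreover have "is_small d W'"
    unfolding is_small_def
  proof (intro conjI allI impI)
    show "card (cells W') \<le> 2 * d * n" if "S = {}"
    proof -
      have "W' = ?W ?\<sigma>" using g that unfolding grows_def by blast
      then show ?thesis using W0(3) by simp
    qed
    fix q assume "3 * n < d * (q + 1) ^ k"
    then have "d * card (cells W') + 6 * (q + 1) * pot W' \<le>
        d * card (cells (?W ?\<sigma>)) + 6 * (q + 1) * pot (?W ?\<sigma>)"
      using g unfolding grows_def by blast
    also have "\<dots> \<le> d * (2 * d * n) + 6 * (q + 1) * (card S * (n * (2 * k + 3)))"
      by (intro add_mono mult_le_mono2 W0(3) pot_le)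
    finally show "d * card (cells W') \<le> d * (2 * d * n) + 6 * (q + 1) * (card S * (n * (2 * k + 3)))"
      by linarith
  qed
  ultimately show ?thesis by simp
qed

text \<open>After the first round \<open>B\<close> is the number of zeros of the matrix kept in
  \<open>H\<close>, so comparing zeros compares numbers of cells. The graph built in round
  \<open>d\<close> serves as the \<open>W\<close> that bounds \<open>H\<close>.\<close>

lemma spanner_prog_correct:
  fixes \<sigma> :: state
  assumes E: "adj n (\<sigma> ''E'') = E" and Sv: "\<forall>i<n. 0 < \<sigma> ''S'' i 0 \<longleftrightarrow> i \<in> S"
    and vals: "\<sigma> ''n'' 0 0 = n" "\<sigma> ''k'' 0 0 = k" "\<sigma> ''B'' 0 0 = 0" and n: "0 < n"
  defines "H \<equiv> adj n (sem n spanner_prog \<sigma> ''H'')"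
  shows "is_spanner H" "d < n \<Longrightarrow> \<exists>W. is_small d W \<and> card (cells H) \<le> card (cells W)"
proof -
  let ?\<sigma> = "sem n (LSet ''M'' (Plus (Plus (Plus (Var ''n'') (Var ''k'')) (Var ''k'')) (Num 2))) \<sigma>"
  have rep: "represented ?\<sigma>" using E Sv vals by (simp add: represented_def)
  let ?H = "\<lambda>\<tau> :: state. adj n (\<tau> ''H'')"
  let ?I = "\<lambda>m \<tau> :: state. (if m = 0 then \<tau> ''B'' 0 0 = 0
      else is_spanner (?H \<tau>) \<and> card (cells (?H \<tau>)) + \<tau> ''B'' 0 0 = n * n) \<and>
    (\<forall>d<m. \<exists>W. is_small d W \<and> card (cells (?H \<tau>)) \<le> card (cells W))"
  have "?I n (sem n spanner_prog \<sigma>)"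
    unfolding spanner_prog_def sem.simps(2)[of _ "LSet ''M'' _"]
  proof (rule sem_For_invariant[where I = ?I])
    show "?I 0 ?\<sigma>" using vals by simp
    show "?I n (upd \<tau> ''d'' 0 0 n)" if "?I n \<tau>" for \<tau> using that by simp
  next
    fix d \<tau>
    assume d: "d < n" and I: "?I d \<tau>"
      and fr: "\<And>y. y \<notin> insert ''d'' (writes (build ;; keep_best)) \<Longrightarrow> \<tau> y = ?\<sigma> y"
    let ?\<tau> = "upd \<tau> ''d'' 0 0 d"
    define \<tau>1 where "\<tau>1 = sem n build ?\<tau>"
    define \<tau>2 where "\<tau>2 = sem n count_zeros \<tau>1"
    define \<tau>3 where "\<tau>3 = sem n (LSet ''B'' (Var ''Z'')) \<tau>2"
    let ?W = "adj n (\<tau>1 ''W'')"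
    have "?\<tau> y = ?\<sigma> y" if "y \<in> {''E'', ''S'', ''k'', ''M''}" for y
    proof -
      have "?\<tau> y = \<tau> y" using that by auto
      also have "\<tau> y = ?\<sigma> y" using that by (intro fr) (auto simp: writes_build writes_keep_best)
      finally show ?thesis .
    qed
    then have "represented ?\<tau>" by (rule represented_cong[OF rep])
    then have W: "is_spanner ?W" "is_small d ?W"
      using build_correct[of ?\<tau> d] by (auto simp: \<tau>1_def)
    have \<tau>1: "\<tau>1 ''B'' = \<tau> ''B''" "\<tau>1 ''H'' = \<tau> ''H''"
      by (simp_all add: \<tau>1_def sem_frame writes_build)
    have \<tau>2: "\<tau>2 ''B'' = \<tau> ''B''" "\<tau>2 ''H'' = \<tau> ''H''" "\<tau>2 ''W'' = \<tau>1 ''W''"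
      by (simp_all add: \<tau>2_def sem_frame writes_count_zeros \<tau>1)
    have Z: "card (cells ?W) + \<tau>2 ''Z'' 0 0 = n * n"
      using card_cells_adj[of "\<tau>1 ''W''"] by (simp add: \<tau>2_def count_zeros_correct)
    have eq: "sem n (build ;; keep_best) ?\<tau> = (if \<tau>2 ''Z'' 0 0 < \<tau>2 ''B'' 0 0 then \<tau>2
        else sem n (fill ''H'' (Cell ''W'' (Var ''u'') (Var ''x''))) \<tau>3)"
      by (simp add: keep_best_def \<tau>1_def \<tau>2_def \<tau>3_def)
    show "?I (Suc d) (sem n (build ;; keep_best) ?\<tau>)"
    proof (cases "\<tau>2 ''Z'' 0 0 < \<tau>2 ''B'' 0 0")
      case True
      \<comment> \<open>In the first round \<open>B\<close> is still \<open>0\<close>, so the graph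
        is stored in \<open>H\<close>; the case at hand belongs to a later round.\<close>
      then have "d \<noteq> 0" using I \<tau>2 by (auto split: if_splits)
      then have "card (cells (?H \<tau>)) + \<tau> ''B'' 0 0 = n * n" using I by simp
      then have "card (cells (?H \<tau>)) \<le> card (cells ?W)" using Z True \<tau>2 by simp
      then show ?thesis using eq True I \<tau>2 W \<open>d \<noteq> 0\<close> by (auto simp: less_Suc_eq)
    next
      case False
      define \<tau>4 where "\<tau>4 = sem n (fill ''H'' (Cell ''W'' (Var ''u'') (Var ''x''))) \<tau>3"
      have "\<forall>i<n. \<forall>j<n. \<tau>4 ''H'' i j = \<tau>3 ''W'' i j"
        unfolding \<tau>4_def by (rule fill_correct) auto
      then have H: "?H \<tau>4 = ?W" using \<tau>2 by (auto simp: adj_def fun_eq_iff \<tau>3_def)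
      have B: "\<tau>4 ''B'' 0 0 = \<tau>2 ''Z'' 0 0"
        unfolding \<tau>4_def by (simp add: sem_frame writes_fill \<tau>3_def)
      have "\<exists>W. is_small d' W \<and> card (cells ?W) \<le> card (cells W)" if "d' < d" for d'
      proof -
        have "card (cells (?H \<tau>)) + \<tau> ''B'' 0 0 = n * n" using I that by simp
        then have "card (cells ?W) \<le> card (cells (?H \<tau>))" using Z False \<tau>2 by simp
        then show ?thesis using I that by (meson le_trans)
      qed
      then show ?thesis unfolding eq using False W Z B H
        by (auto simp: less_Suc_eq simp flip: \<tau>4_def)
    qed
  qed
  then show "is_spanner H" "d < n \<Longrightarrow> \<exists>W. is_small d W \<and> card (cells H) \<le> card (cells W)"
    unfolding H_def using n by auto
qed

end


section \<open>The size bound and the decoded spanner\<close>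

text \<open>With \<open>d\<close> about \<open>r\<close> and \<open>q + 1\<close> between
  \<open>3 * y\<close> and \<open>4 * y\<close>, the identity \<open>r * y ^ k = n\<close> makes the
  condition on \<open>q\<close> hold, and \<open>y * (k * s) = r ^ 2\<close> makes both terms of
  order \<open>n * r\<close> after division by \<open>d\<close>.\<close>

lemma balanced_size_bound:
  fixes n k s c :: nat
  assumes "1 \<le> n" "1 \<le> k" "1 \<le> s" and c: "c \<le> n * n"
    and small: "\<And>d q. d < n \<Longrightarrow> 3 * n < d * (q + 1) ^ k \<Longrightarrow>
      d * c \<le> d * (2 * d * n) + 6 * (q + 1) * (s * (n * (2 * k + 3)))"
  shows "real c \<le> 124 * (real n powr (1 + 1 / (2 * real k + 1))
     * (real k * real s) powr (real k / (2 * real k + 1)))"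
proof -
  \<comment> \<open>\<open>r\<close> is the real value of \<open>d\<close> that balances the two terms, and \<open>q + 1\<close> is taken of order \<open>y\<close>.\<close>
  define r where "r = real n powr (1 / (2 * real k + 1)) * (real k * real s) powr (real k / (2 * real k + 1))"
  define y where "y = r ^ 2 / (real k * real s)"
  have ks: "1 \<le> real k * real s" using assms by (simp add: mult_ge1_I)
  have r1: "1 \<le> r" unfolding r_def using ks assms by (intro mult_ge1_I ge_one_powr_ge_zero) auto
  have "r ^ (2 * k + 1) = r powr (2 * real k + 1)"
    using r1 powr_realpow[of r "2 * k + 1"] by (simp add: add.commute)
  also have "\<dots> = real n * (real k * real s) ^ k"
    using assms ks unfolding r_def by (simp add: powr_mult powr_powr powr_realpow power_mult_distrib)
  finally have "r ^ (2 * k + 1) = real n * (real k * real s) ^ k" .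
  then have yk: "y ^ k = real n / r"
    using r1 ks assms(3) by (simp add: y_def power_divide power_mult[symmetric] field_simps)
  have y0: "0 < y" using r1 ks by (simp add: y_def)
  have yks: "y * (real k * real s) = r ^ 2" using assms(2,3) by (simp add: y_def)
  have target: "real n powr (1 + 1 / (2 * real k + 1)) * (real k * real s) powr (real k / (2 * real k + 1))
      = real n * r"
    using assms by (simp add: r_def powr_add)
  have "real c \<le> 124 * (real n * r)"
  proof (cases "real n \<le> 2 * r")
    case True
    \<comment> \<open>Here the rounded \<open>r\<close> may fall outside the range of
      \<open>d\<close>, but the trivial bound is good enough.\<close>
    have "real c \<le> real n * real n" using c by (metis of_nat_le_iff of_nat_mult)
    also have "\<dots> \<le> real n * (2 * r)" using True by (intro mult_left_mono) auto
    also have "\<dots> \<le> 124 * (real n * r)" using r1 by simp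
    finally show ?thesis .
  next
    case False
    have "1 \<le> y ^ k" using False r1 by (simp add: yk field_simps)
    \<comment> \<open>A \<open>y\<close> of at least \<open>1\<close> leaves room for the integer
      \<open>q + 1\<close> between \<open>3 * y\<close> and \<open>4 * y\<close>.\<close>
    then have y1: "1 \<le> y" using y0 assms(2) power_less_one_iff[of y k] by (meson less_imp_le not_less less_le_trans zero_less_one)
    define d where "d = nat \<lceil>r\<rceil>"
    define q where "q = nat \<lfloor>3 * y\<rfloor>"
    have d: "r \<le> real d" "real d \<le> 2 * r" using r1 unfolding d_def by linarith+
    have "d < n" using d(2) False by linarith
    have q: "3 * y < real q + 1" "real q + 1 \<le> 4 * y" using y1 unfolding q_def by linarith+
    \<comment> \<open>The factor \<open>3\<close> is absorbed into the base of the power, as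
      \<open>3 \<le> 3 ^ k\<close> for positive \<open>k\<close>.\<close>
    have "3 * real n = 3 * (y ^ k * r)" using yk r1 by simp
    also have "\<dots> \<le> 3 ^ k * (y ^ k * r)"
      using y0 r1 assms(2) self_le_power[of "3 :: real" k] by (intro mult_right_mono) auto
    also have "\<dots> = (3 * y) ^ k * r" by (simp add: power_mult_distrib)
    also have "\<dots> < (real q + 1) ^ k * r"
      using q(1) y0 r1 assms(2) by (intro mult_strict_right_mono power_strict_mono) auto
    also have "\<dots> \<le> (real q + 1) ^ k * real d" using d(1) by (intro mult_left_mono) auto
    also have "\<dots> = real (d * (q + 1) ^ k)" by (simp add: add.commute mult.commute)
    finally have "3 * n < d * (q + 1) ^ k" by (metis of_nat_less_iff of_nat_mult of_nat_numeral)
    from small[OF \<open>d < n\<close> this]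
    have "real (d * c) \<le> real (d * (2 * d * n) + 6 * (q + 1) * (s * (n * (2 * k + 3))))"
      by (simp only: of_nat_le_iff)
    then have "real d * real c \<le> real d * (2 * real d * real n) + 6 * (real q + 1) * (real s * (real n * (2 * real k + 3)))"
      by (simp add: add.commute)
    \<comment> \<open>Uses \<open>2 * k + 3 \<le> 5 * k\<close>. The greedy part contributes
      \<open>2 * 2 = 4\<close> and the purchases \<open>6 * 4 * 5 = 120\<close>, in total
      \<open>124\<close>.\<close>
    also have "\<dots> \<le> real d * (2 * (2 * r) * real n) + 6 * (4 * y) * (real s * (real n * (5 * real k)))"
      using d(2) q(2) y0 assms(2) by (intro add_mono mult_mono) auto
    also have "6 * (4 * y) * (real s * (real n * (5 * real k))) = 120 * real n * (y * (real k * real s))"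
      by simp
    also have "\<dots> = r * (120 * real n * r)" by (simp add: yks power2_eq_square)
    also have "\<dots> \<le> real d * (120 * real n * r)" using d(1) r1 by (intro mult_right_mono) auto
    finally have "real d * real c \<le> real d * (124 * (real n * r))" by (simp add: algebra_simps)
    moreover have "0 < real d" using d(1) r1 by linarith
    ultimately show ?thesis by (simp only: mult_le_cancel_left_pos)
  qed
  then show ?thesis by (simp only: target)
qed

section \<open>Walks in the graph as powers of a relation on indices\<close>

lemma walk_relpowp:
  fixes E :: "'a set set"
  assumes vs: "distinct vs" "set vs = V" and g: "graph V E" and j: "j < length vs"
  defines "A \<equiv> \<lambda>i j. i < length vs \<and> j < length vs \<and> {vs ! i, vs ! j} \<in> E"
  shows "walk V E p \<Longrightarrow> hd p = vs ! i \<Longrightarrow> last p = vs ! j \<Longrightarrow> i < length vs \<Longrightarrow>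
    (A ^^ (length p - 1)) i j"
proof (induction p arbitrary: i)
  case (Cons u p)
  show ?case
  proof (cases p)
    case Nil
    then have "i = j" using Cons.prems vs(1) j nth_eq_iff_index_eq by force
    then show ?thesis using Nil by simp
  next
    case p: (Cons v p')
    then have uv: "{vs ! i, v} \<in> E" "walk V E p" using Cons.prems by auto
    then have "v \<in> V" using g by (auto simp: graph_def)
    then obtain m where m: "m < length vs" "v = vs ! m" using vs(2) by (metis in_set_conv_nth)
    have "(A ^^ (length p - 1)) m j" using Cons.IH[of m] uv Cons.prems m p by auto
    moreover have "A i m" using uv m Cons.prems by (simp add: A_def)
    ultimately have "(A ^^ Suc (length p - 1)) i j" by (rule relpowp_Suc_I2[rotated])
    then show ?thesis using p by simp
  qed
qed simp

lemma relpowp_walk: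
  assumes "\<And>x y. A x y \<Longrightarrow> x < length vs \<and> y < length vs \<and> {vs ! x, vs ! y} \<in> H"
  shows "(A ^^ l) i j \<Longrightarrow> i < length vs \<Longrightarrow>
    \<exists>p. walk (set vs) H p \<and> hd p = vs ! i \<and> last p = vs ! j \<and> length p = Suc l"
proof (induction l arbitrary: i)
  case 0
  then show ?case by (intro exI[of _ "[vs ! i]"]) simp
next
  case (Suc l)
  then obtain m where m: "A i m" "(A ^^ l) m j" by (meson relpowp_Suc_D2)
  then obtain p where p: "walk (set vs) H p" "hd p = vs ! m" "last p = vs ! j" "length p = Suc l"
    using Suc.IH assms by blast
  then obtain p' where p': "p = vs ! m # p'" by (cases p) auto
  then show ?case using p assms[OF m(1)] by (intro exI[of _ "vs ! i # p"]) auto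
qed

lemma graph_dist_le: "walk V E p \<Longrightarrow> graph_dist V E (hd p) (last p) \<le> enat (length p - 1)"
  unfolding graph_dist_def by (rule INF_lower) simp

text \<open>A set of extended naturals with finite infimum is nonempty, and the infimum of a
  nonempty one is its least element.\<close>

lemma graph_dist_attained:
  assumes "graph_dist V E u v = enat l"
  obtains p where "walk V E p" "hd p = u" "last p = v" "l = length p - 1"
proof -
  let ?A = "(\<lambda>p. enat (length p - 1)) ` {p. walk V E p \<and> hd p = u \<and> last p = v}"
  have "?A \<noteq> {}" using assms unfolding graph_dist_def by (metis Inf_enat_def enat.distinct(2))
  then have "Inf ?A \<in> ?A" unfolding Inf_enat_def by (auto intro: LeastI)
  then show ?thesis using assms that unfolding graph_dist_def by auto
qed

lemma pairwise_spanner_decode: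
  fixes E :: "'a set set"
  assumes g: "graph V E" and vs: "distinct vs" "set vs = V" and S: "S \<subseteq> V"
  defines "n \<equiv> length vs"
  defines "A \<equiv> \<lambda>i j. i < n \<and> j < n \<and> {vs ! i, vs ! j} \<in> E"
  assumes H: "spanner_input n A k {i. i < n \<and> vs ! i \<in> S}"
    "spanner_input.is_spanner n A k {i. i < n \<and> vs ! i \<in> S} (adj n (\<tau> ''H''))"
  shows "pairwise_spanner 1 (2 * real k) (S \<times> V) V E (decode_output vs \<tau>)"
proof -
  interpret spanner_input n A k "{i. i < n \<and> vs ! i \<in> S}" by fact
  let ?H = "adj n (\<tau> ''H'')"
  have sub: "subgraph ?H" and near: "\<And>s v. s < n \<Longrightarrow> vs ! s \<in> S \<Longrightarrow> v < n \<Longrightarrow>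
      \<delta> ?H s v \<le> \<delta> A s v + k + k"
    using H(2) by (auto simp: is_spanner_def)
  have "\<forall>i j. ?H i j \<longrightarrow> A i j" using sub unfolding subgraph_def by blast
  then have "?H i j \<Longrightarrow> {vs ! i, vs ! j} \<in> E" for i j
    unfolding A_def by blast
  then have HE: "decode_output vs \<tau> \<subseteq> E"
    by (auto simp: decode_output_def adj_def n_def)
  have "ereal_of_enat (graph_dist V (decode_output vs \<tau>) s t)
      \<le> ereal 1 * ereal_of_enat (graph_dist V E s t) + ereal (2 * real k)" if "s \<in> S" "t \<in> V" for s t
  proof (cases "graph_dist V E s t")
    case infinity
    then show ?thesis by simp
  next
    case (enat l)
    then obtain p where p: "walk V E p" "hd p = s" "last p = t" "l = length p - 1"
      by (rule graph_dist_attained)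
    have "s \<in> set vs" "t \<in> set vs" using that S vs(2) by auto
    then obtain i j where i: "i < n" "vs ! i = s" and j: "j < n" "vs ! j = t"
      unfolding n_def by (auto simp: in_set_conv_nth)
    have "(A ^^ l) i j" unfolding A_def n_def
      using walk_relpowp[OF vs g, of j p i] p i j n_def by simp
    then have dA: "\<delta> A i j \<le> l" "\<delta> A i j < n" using dist_cap_le dist_cap_lt i by auto
    then have dH: "\<delta> ?H i j \<le> \<delta> A i j + k + k" using near i j that by simp
    \<comment> \<open>The bound \<open>\<delta> A i j + k + k\<close> is below \<open>M\<close>, so
      \<open>?H\<close> really connects \<open>i\<close> and \<open>j\<close>.\<close>
    then have "(?H ^^ \<delta> ?H i j) i j"
      using sub i dA by (cases rule: nat_graph.dist_cap_cases[of n ?H i M j]) (auto simp: subgraph_def)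
    then obtain p' where p': "walk (set vs) (decode_output vs \<tau>) p'" "hd p' = vs ! i" "last p' = vs ! j"
      "length p' = Suc (\<delta> ?H i j)"
      using relpowp_walk[of ?H vs "decode_output vs \<tau>" "\<delta> ?H i j" i j] i
      by (auto simp: adj_def decode_output_def n_def)
    have "graph_dist V (decode_output vs \<tau>) s t \<le> enat (\<delta> ?H i j)"
      using graph_dist_le[OF p'(1)] p' i j vs(2) by simp
    also have "\<dots> \<le> enat (l + 2 * k)" using dA dH by simp
    finally have "ereal_of_enat (graph_dist V (decode_output vs \<tau>) s t) \<le> ereal_of_enat (enat (l + 2 * k))"
      by (simp only: ereal_of_enat_le_iff)
    then show ?thesis using enat by simp
  qed
  then show ?thesis using HE S by (auto simp: pairwise_spanner_def)
qed

theorem theorem4: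
  shows "\<exists>(prog :: com) (p :: nat poly) (C :: real). C > 0 \<and>
    (\<forall>(V :: 'a set) (E :: 'a set set) (vs :: 'a list) (S :: 'a set) (n :: nat) (k :: nat).
       graph V E \<and> card V = n \<and> distinct vs \<and> set vs = V \<and> S \<subseteq> V \<and> k \<ge> 1 \<longrightarrow>
       (\<exists>(t :: nat) (\<sigma> :: state).
          exec prog (encode_input vs E S k) t \<sigma> \<and>
          t \<le> poly p (input_size n k) \<and>
          pairwise_spanner 1 (2 * real k) (S \<times> V) V E (decode_output vs \<sigma>) \<and>
          real (card (decode_output vs \<sigma>))
            \<le> C * (real n powr (1 + 1 / (2 * real k + 1))
                   * (real k * real (card S)) powr (real k / (2 * real k + 1)))))"
proof (intro exI[of _ "compile spanner_prog"] exI[of _ "time_poly spanner_prog"] exI[of _ "124 :: real"]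
    conjI allI impI)
  show "(0 :: real) < 124" by simp
next
  fix V :: "'a set" and E :: "'a set set" and vs :: "'a list" and S :: "'a set" and n k :: nat
  assume "graph V E \<and> card V = n \<and> distinct vs \<and> set vs = V \<and> S \<subseteq> V \<and> k \<ge> 1"
  then have g: "graph V E" and n: "card V = n" and vs: "distinct vs" "set vs = V"
    and S: "S \<subseteq> V" and k: "k \<ge> 1" by auto
  have len: "length vs = n" using n vs distinct_card by force
  let ?\<sigma> = "encode_input vs E S k"
  define \<tau> where "\<tau> = sem n spanner_prog ?\<sigma>"
  let ?bound = "124 * (real n powr (1 + 1 / (2 * real k + 1))
     * (real k * real (card S)) powr (real k / (2 * real k + 1)))"
  have "?\<sigma> ''n'' 0 0 = n" by (simp add: encode_input_def len)
  then obtain t where t: "t \<le> poly (time_poly spanner_prog) n" "exec (compile spanner_prog) ?\<sigma> t \<tau>"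
    unfolding \<tau>_def using exec_compile[OF wf_spanner_prog writes_spanner_prog] by blast
  \<comment> \<open>The time is bounded in terms of \<open>n\<close> alone, as \<open>k\<close>
    occurs in additions and comparisons but in no loop bound.\<close>
  have "poly (time_poly spanner_prog) n \<le> poly (time_poly spanner_prog) (input_size n k)"
    by (rule poly_nat_mono) (simp add: input_size_def)
  with t(1) have time: "t \<le> poly (time_poly spanner_prog) (input_size n k)" by simp
  have "pairwise_spanner 1 (2 * real k) (S \<times> V) V E (decode_output vs \<tau>) \<and>
      real (card (decode_output vs \<tau>)) \<le> ?bound"
  proof (cases "n = 0")
    case True
    then have "decode_output vs \<tau> = {}" "V = {}" using len vs(2) by (auto simp: decode_output_def)
    then show ?thesis using S by (auto simp: pairwise_spanner_def)
  next
    case False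
    define A where "A = (\<lambda>i j. i < n \<and> j < n \<and> {vs ! i, vs ! j} \<in> E)"
    define S' where "S' = {i. i < n \<and> vs ! i \<in> S}"
    interpret spanner_input n A k S'
      by unfold_locales (use k in \<open>auto simp: A_def S'_def insert_commute\<close>)
    let ?H = "adj n (\<tau> ''H'')"
    have "bij_betw (nth vs) S' S"
      unfolding bij_betw_def S'_def
    proof
      show "inj_on (nth vs) {i. i < n \<and> vs ! i \<in> S}"
        using vs(1) len by (auto simp: inj_on_def nth_eq_iff_index_eq)
      show "nth vs ` {i. i < n \<and> vs ! i \<in> S} = S"
        using vs(2) S len by (auto simp: image_iff set_conv_nth)
    qed
    then have cS: "card S' = card S" by (rule bij_betw_same_card)
    have pre: "adj n (?\<sigma> ''E'') = A" "\<forall>i<n. 0 < ?\<sigma> ''S'' i 0 \<longleftrightarrow> i \<in> S'" "?\<sigma> ''n'' 0 0 = n"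
      "?\<sigma> ''k'' 0 0 = k" "?\<sigma> ''B'' 0 0 = 0" "0 < n"
      using False by (auto simp: adj_def A_def S'_def encode_input_def len fun_eq_iff)
    have span: "is_spanner ?H" unfolding \<tau>_def by (rule spanner_prog_correct(1)[OF pre])
    have best: "\<exists>W. is_small d W \<and> card (cells ?H) \<le> card (cells W)" if "d < n" for d
      unfolding \<tau>_def by (rule spanner_prog_correct(2)[OF pre that])
    \<comment> \<open>An edge may be read off from two cells, so this map is not injective in
      general and only an inequality follows.\<close>
    have "decode_output vs \<tau> = (\<lambda>(i, j). {vs ! i, vs ! j}) ` cells ?H"
      by (auto simp: decode_output_def cells_def adj_def len image_iff)
    moreover have fin: "finite (cells ?H)" using span finite_cells by (simp add: is_spanner_def)
    ultimately have cd: "card (decode_output vs \<tau>) \<le> card (cells ?H)" by (simp add: card_image_le)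
    have "real (card (cells ?H)) \<le> ?bound"
    proof (cases "S' = {}")
      case True
      \<comment> \<open>For empty \<open>S\<close> the claimed bound is \<open>0\<close>, because
        \<open>0 powr x = 0\<close>. The round \<open>d = 0\<close> starts from the empty graph and
        buys nothing.\<close>
      obtain W where "is_small 0 W" "card (cells ?H) \<le> card (cells W)" using best[of 0] False by blast
      moreover from this(1) have "card (cells W) \<le> 2 * 0 * n" using True unfolding is_small_def by blast
      ultimately show ?thesis by simp
    next
      case ne: False
      have "finite S'" by (simp add: S'_def)
      show ?thesis
      proof (rule balanced_size_bound)
        show "1 \<le> n" "1 \<le> k" using False k by auto
        show "1 \<le> card S" using ne \<open>finite S'\<close> unfolding cS[symmetric]
          by (simp add: Suc_le_eq card_gt_0_iff)
        show "card (cells ?H) \<le> n * n" using card_cells_adj[of "\<tau> ''H''"] by linarith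
        fix d q assume "d < n" and q: "3 * n < d * (q + 1) ^ k"
        then obtain W where W: "is_small d W" "card (cells ?H) \<le> card (cells W)" using best by blast
        have "d * card (cells ?H) \<le> d * card (cells W)" using W(2) by simp
        also have "\<dots> \<le> d * (2 * d * n) + 6 * (q + 1) * (card S' * (n * (2 * k + 3)))"
          using W(1) q unfolding is_small_def by blast
        finally show "d * card (cells ?H) \<le> d * (2 * d * n) + 6 * (q + 1) * (card S * (n * (2 * k + 3)))"
          by (simp only: cS)
      qed
    qed
    moreover have "pairwise_spanner 1 (2 * real k) (S \<times> V) V E (decode_output vs \<tau>)"
      by (rule pairwise_spanner_decode[OF g vs S])
        (use span spanner_input_axioms in \<open>simp_all add: len A_def S'_def\<close>)
    ultimately show ?thesis using cd by linarith
  qed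
  then show "\<exists>t \<sigma>. exec (compile spanner_prog) ?\<sigma> t \<sigma> \<and> t \<le> poly (time_poly spanner_prog) (input_size n k) \<and>
      pairwise_spanner 1 (2 * real k) (S \<times> V) V E (decode_output vs \<sigma>) \<and>
      real (card (decode_output vs \<sigma>)) \<le> ?bound"
    using t(2) time by blast
qed

end
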